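(* Let $d=\sum_{j=1}^r d_j\ge 3$ with $r\ge 2$ and integers $d_j\ge 1$, $j=1,\dots,r$. Let $V$ and $Y$ be real-valued $\Gamma$-periodic functions on $\mathbb{Z}^d$, and assume that $V$ is $(d_1,d_2,\dots,d_r)$-separable. Suppose further that for any $1\le i<m\le r$ and any $s\in I_i$, $t\in I_m$, there exist $\lambda_1=\lambda_1(s,t)\in\mathbb{C}$, $\lambda_2=\lambda_2(s,t)\in\mathbb{C}$ and a set $S=S(s,t)\subset\{1,2,\dots,d\}$ with $s,t\in S$ and $\#S\ge 3$, such that $V$ and $Y$ are generalized partially Fermi isospectral with respect to $(S,\lambda_1,\lambda_2)$. Then $Y$ is also $(d_1,d_2,\dots,d_r)$-separable.
   Context: Let $q_1,\dots,q_d$ be pairwise coprime positive integers, $\Gamma=q_1\mathbb{Z}\oplus\cdots\oplus q_d\mathbb{Z}$, $Q=q_1q_2\cdots q_d$. A function $V:\mathbb{Z}^d\to\mathbb{C}$ is $\Gamma$-periodic if $V(n+\gamma)=V(n)$ for all $n\in\mathbb{Z}^d$, $\gamma\in\Gamma$. The discrete Laplacian is $(\Delta u)(n)=\sum_{\|n'-n\|=1}u(n')$ with $\|n'-n\|=\sum_{l=1}^d|n_l-n'_l|$. For $k=(k_1,\dots,k_d)$, the functions $u:\mathbb{Z}^d\to\mathbb{C}$ satisfying the Floquet-Bloch condition $u(n+q_j\mathbf{e}_j)=e^{2\pi \mathrm{i}k_j}u(n)$ for all $n\in\mathbb{Z}^d$, $j=1,\dots,d$ ($\mathbf{e}_j$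 the standard basis) form a $Q$-dimensional space, each such $u$ being determined by its values on $W=\{n\in\mathbb{Z}^d:0\le n_j\le q_j-1,\ j=1,\dots,d\}$. For $\Gamma$-periodic $V$ the operator $\Delta+V$ preserves this space, and $D_V(k)$ denotes the $Q\times Q$ matrix of its restriction in the coordinates $(u(n))_{n\in W}$. Put $P_V(k,\lambda)=\det(D_V(k)-\lambda I)$. Generalized partial Fermi isospectrality ($d\ge2$): for a non-empty set $S\subset\{1,\dots,d\}$ and $\lambda_1,\lambda_2\in\mathbb{C}$, two $\Gamma$-periodic functions $V$ and $Y$ are generalized partially Fermi isospectral with respect to $(S,\lambda_1,\lambda_2)$ if there exist $k_j^*\in\mathbb{R}$ for each $j\in\{1,\dots,d\}\setminus S$ such that for all choices of $k_j\in\mathbb{R}$, $j\in S$, one has $P_V(k,\lambda_1)=P_Y(k,\lambda_2)$, where $k=(k_1,\dots,k_d)$ with $k_j=k_j^*$ for $j\notin S$. Blocks: put $d_0=0$ and, for $m=1,\dots,r$, $I_m=\{1+\sum_{j=0}^{m-1}d_j,\ 2+\sum_{j=0}^{m-1}d_j,\dots,\sum_{j=0}^{m}d_j\}$; for $n\in\mathbb{Z}^d$ let $\tilde n_m\in\mathbb{Z}^{d_m}$ be the vector of the components of $n$ with indices in $I_m$, so $n=(\tilde n_1,\dots,\tilde n_r)$. A function $V$ on $\mathbb{Z}^d$ is $(d_1,\dots,d_r)$-separable if there exist functions $V_j$ on $\mathbb{Z}^{d_j}$, $j=1,\dots,r$, such that $V(n)=V_1(\tilde n_1)+V_2(\tilde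 n_2)+\cdots+V_r(\tilde n_r)$ for all $n\in\mathbb{Z}^d$. *)

theory Defs
  imports Complex_Main "Jordan_Normal_Form.Determinant"
begin

text \<open>
  Points of \<open>Z^d\<close> are the integer vectors in \<open>carrier_vec d\<close>, so coordinates and blocks are
  indexed from \<open>0\<close>: \<open>{1,...,d}\<close> becomes \<open>{..<d}\<close>. A function on \<open>Z^d\<close> is a function on
  \<open>int vec\<close> of which only the values on \<open>carrier_vec d\<close> are ever used; likewise only the
  values \<open>q j\<close> and \<open>k j\<close> with \<open>j < d\<close> matter.
\<close>

definition period_lattice :: "nat \<Rightarrow> (nat \<Rightarrow> nat) \<Rightarrow> int vec set" where
  "period_lattice d q = {\<gamma> \<in> carrier_vec d. \<forall>j<d. int (q j) dvd \<gamma> $ j}"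

definition periodic :: "nat \<Rightarrow> (nat \<Rightarrow> nat) \<Rightarrow> (int vec \<Rightarrow> complex) \<Rightarrow> bool" where
  "periodic d q V \<longleftrightarrow> (\<forall>n\<in>carrier_vec d. \<forall>\<gamma>\<in>period_lattice d q. V (n + \<gamma>) = V n)"

definition l1_norm :: "int vec \<Rightarrow> int" where
  "l1_norm n = (\<Sum>l<dim_vec n. \<bar>n $ l\<bar>)"

definition laplacian :: "nat \<Rightarrow> (int vec \<Rightarrow> complex) \<Rightarrow> int vec \<Rightarrow> complex" where
  "laplacian d u n = (\<Sum>n' \<in> {n' \<in> carrier_vec d. l1_norm (n' - n) = 1}. u n')"

definition schroedinger ::
    "nat \<Rightarrow> (int vec \<Rightarrow> complex) \<Rightarrow> (int vec \<Rightarrow> complex) \<Rightarrow> int vec \<Rightarrow> complex" where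
  "schroedinger d V u n = laplacian d u n + V n * u n"

definition floquet_space ::
    "nat \<Rightarrow> (nat \<Rightarrow> nat) \<Rightarrow> (nat \<Rightarrow> real) \<Rightarrow> (int vec \<Rightarrow> complex) set" where
  "floquet_space d q k = {u. \<forall>n\<in>carrier_vec d. \<forall>j<d.
     u (n + int (q j) \<cdot>\<^sub>v unit_vec d j) = cis (2 * pi * k j) * u n}"

definition fund_cell :: "nat \<Rightarrow> (nat \<Rightarrow> nat) \<Rightarrow> int vec set" where
  "fund_cell d q = {n \<in> carrier_vec d. \<forall>j<d. 0 \<le> n $ j \<and> n $ j \<le> int (q j) - 1}"

text \<open>
  The element of \<open>floquet_space d q k\<close> that is \<open>1\<close> at the point \<open>w\<close> of the fundamental cell and
  \<open>0\<close> at all other points of the cell. See \<open>floquet_delta_in_space\<close>, \<open>floquet_delta_on_cell\<close> and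
  \<open>floquet_expansion\<close> below.
\<close>

definition floquet_delta ::
    "nat \<Rightarrow> (nat \<Rightarrow> nat) \<Rightarrow> (nat \<Rightarrow> real) \<Rightarrow> int vec \<Rightarrow> int vec \<Rightarrow> complex" where
  "floquet_delta d q k w n =
     (if \<forall>j<d. n $ j mod int (q j) = w $ j
      then cis (2 * pi * (\<Sum>j<d. k j * real_of_int (n $ j div int (q j)))) else 0)"

text \<open>
  Mixed-radix enumeration of the fundamental cell by \<open>{..<Q}\<close>. The determinant of the Floquet
  matrix does not depend on the enumeration chosen.
\<close>

definition site :: "nat \<Rightarrow> (nat \<Rightarrow> nat) \<Rightarrow> nat \<Rightarrow> int vec" where
  "site d q i = vec d (\<lambda>j. int (i div (\<Prod>l<j. q l) mod q j))"

definition floquet_matrix ::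
    "nat \<Rightarrow> (nat \<Rightarrow> nat) \<Rightarrow> (int vec \<Rightarrow> complex) \<Rightarrow> (nat \<Rightarrow> real) \<Rightarrow> complex mat" where
  "floquet_matrix d q V k =
     mat (\<Prod>j<d. q j) (\<Prod>j<d. q j)
       (\<lambda>(a, b). schroedinger d V (floquet_delta d q k (site d q b)) (site d q a))"

definition char_det ::
    "nat \<Rightarrow> (nat \<Rightarrow> nat) \<Rightarrow> (int vec \<Rightarrow> complex) \<Rightarrow> (nat \<Rightarrow> real) \<Rightarrow> complex \<Rightarrow> complex" where
  "char_det d q V k z =
     det (floquet_matrix d q V k - z \<cdot>\<^sub>m 1\<^sub>m (\<Prod>j<d. q j))"

definition partially_fermi_isospectral ::
    "nat \<Rightarrow> (nat \<Rightarrow> nat) \<Rightarrow> nat set \<Rightarrow> complex \<Rightarrow> complex \<Rightarrow>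
      (int vec \<Rightarrow> complex) \<Rightarrow> (int vec \<Rightarrow> complex) \<Rightarrow> bool" where
  "partially_fermi_isospectral d q S z1 z2 V Y \<longleftrightarrow>
     S \<noteq> {} \<and> S \<subseteq> {..<d} \<and> periodic d q V \<and> periodic d q Y \<and>
     (\<exists>k0 :: nat \<Rightarrow> real. \<forall>k :: nat \<Rightarrow> real.
        (\<forall>j\<in>{..<d} - S. k j = k0 j) \<longrightarrow> char_det d q V k z1 = char_det d q Y k z2)"

text \<open>In what follows \<open>ds m\<close> is the length of block number \<open>m\<close>.\<close>

definition block_indices :: "(nat \<Rightarrow> nat) \<Rightarrow> nat \<Rightarrow> nat set" where
  "block_indices ds m = {(\<Sum>j<m. ds j)..<(\<Sum>j<Suc m. ds j)}"

definition block :: "(nat \<Rightarrow> nat) \<Rightarrow> nat \<Rightarrow> int vec \<Rightarrow> int vec" where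
  "block ds m n = vec (ds m) (\<lambda>i. n $ ((\<Sum>j<m. ds j) + i))"

definition separable :: "nat \<Rightarrow> (nat \<Rightarrow> nat) \<Rightarrow> (int vec \<Rightarrow> complex) \<Rightarrow> bool" where
  "separable r ds V \<longleftrightarrow>
     (\<exists>F :: nat \<Rightarrow> int vec \<Rightarrow> complex.
        \<forall>n\<in>carrier_vec (\<Sum>j<r. ds j). V n = (\<Sum>m<r. F m (block ds m n)))"

lemma finite_neighbours:
  assumes "n \<in> carrier_vec d"
  shows "finite {n' \<in> carrier_vec d. l1_norm (n' - n) = 1}"
proof -
  let ?A = "{n' \<in> carrier_vec d. l1_norm (n' - n) = 1}"
  let ?B = "PiE {..<d} (\<lambda>j. {n $ j - 1..n $ j + 1})"
  let ?f = "\<lambda>x :: int vec. \<lambda>j\<in>{..<d}. x $ j"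
  have "?f ` ?A \<subseteq> ?B"
  proof (intro image_subsetI PiE_I)
    fix x j assume x: "x \<in> ?A" and j: "j \<in> {..<d}"
    have "\<bar>(x - n) $ j\<bar> \<le> (\<Sum>l<d. \<bar>(x - n) $ l\<bar>)"
      using j by (intro member_le_sum) auto
    also have "\<dots> = 1" using x assms by (simp add: l1_norm_def)
    finally have "\<bar>x $ j - n $ j\<bar> \<le> 1" using x j assms by simp
    then show "?f x j \<in> {n $ j - 1..n $ j + 1}" using j by auto
  qed auto
  moreover have "finite ?B" by (intro finite_PiE) auto
  moreover have "inj_on ?f ?A"
  proof (rule inj_onI)
    fix x y assume x: "x \<in> ?A" and y: "y \<in> ?A" and eq: "?f x = ?f y"
    have "x $ j = y $ j" if "j < d" for j
      using fun_cong[OF eq, of j] that by simp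
    then show "x = y" using x y by (intro eq_vecI) auto
  qed
  ultimately show ?thesis by (meson finite_imageD finite_subset)
qed

lemma mixed_radix_exists:
  fixes q w :: "nat \<Rightarrow> nat"
  assumes "\<And>j. j < d \<Longrightarrow> w j < q j"
  shows "\<exists>i < (\<Prod>j<d. q j). \<forall>j<d. i div (\<Prod>l<j. q l) mod q j = w j"
  using assms
proof (induction d)
  case 0
  then show ?case by simp
next
  case (Suc d)
  then obtain i where i: "i < (\<Prod>j<d. q j)" "\<And>j. j < d \<Longrightarrow> i div (\<Prod>l<j. q l) mod q j = w j"
    by auto
  define P where "P = (\<Prod>j<d. q j)"
  have wd: "w d < q d" using Suc.prems by simp
  have iP: "i < P" using i P_def by simp
  have "(i + P * w d) div (\<Prod>l<j. q l) mod q j = w j" if "j < Suc d" for j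
  proof (cases "j = d")
    case True
    then show ?thesis using iP wd by (simp flip: P_def)
  next
    case False
    then have j: "j < d" using that by simp
    have "(\<Prod>l<Suc j. q l) dvd P" unfolding P_def
      using j by (intro prod_dvd_prod_subset) auto
    then obtain c where c: "P = (\<Prod>l<j. q l) * q j * c" by auto
    have pos: "(\<Prod>l<j. q l) > 0" using iP c by (intro gr0I) auto
    have "(i + P * w d) div (\<Prod>l<j. q l) = i div (\<Prod>l<j. q l) + q j * (c * w d)"
      using pos by (simp add: c mult.assoc)
    then show ?thesis using i(2)[OF j] by simp
  qed
  moreover have "i + P * w d < (\<Prod>j<Suc d. q j)"
  proof -
    have "i + P * w d < P * Suc (w d)" using iP by simp
    also have "\<dots> \<le> P * q d" using wd by (intro mult_left_mono) auto
    finally show ?thesis by (simp add: P_def)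
  qed
  ultimately show ?case by blast
qed

lemma mixed_radix_inj:
  fixes q :: "nat \<Rightarrow> nat"
  assumes "i < (\<Prod>j<d. q j)" "i' < (\<Prod>j<d. q j)"
    and "\<And>j. j < d \<Longrightarrow> i div (\<Prod>l<j. q l) mod q j = i' div (\<Prod>l<j. q l) mod q j"
  shows "i = i'"
proof -
  have "e \<le> d \<Longrightarrow> i mod (\<Prod>l<e. q l) = i' mod (\<Prod>l<e. q l)" for e
    by (induction e) (auto simp: mod_mult2_eq assms(3))
  from this[of d] show ?thesis using assms(1,2) by simp
qed

lemma site_bij_betw:
  assumes "\<And>j. j < d \<Longrightarrow> q j > 0"
  shows "bij_betw (site d q) {..<(\<Prod>j<d. q j)} (fund_cell d q)"
proof (rule bij_betw_imageI)
  show "inj_on (site d q) {..<(\<Prod>j<d. q j)}"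
  proof (rule inj_onI)
    fix i i' assume i: "i \<in> {..<(\<Prod>j<d. q j)}" "i' \<in> {..<(\<Prod>j<d. q j)}"
      and eq: "site d q i = site d q i'"
    show "i = i'"
    proof (rule mixed_radix_inj[of i q d i'])
      fix j assume "j < d"
      with arg_cong[OF eq, of "\<lambda>v. v $ j"]
      show "i div (\<Prod>l<j. q l) mod q j = i' div (\<Prod>l<j. q l) mod q j"
        by (simp add: site_def del: of_nat_mod)
    qed (use i in auto)
  qed
next
  show "site d q ` {..<(\<Prod>j<d. q j)} = fund_cell d q"
  proof (intro equalityI subsetI)
    fix w assume "w \<in> site d q ` {..<(\<Prod>j<d. q j)}"
    then obtain i where w: "w = site d q i" by auto
    have "int (i div (\<Prod>l<j. q l) mod q j) < int (q j)" if "j < d" for j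
      using assms[OF that] by (simp del: of_nat_mod)
    then show "w \<in> fund_cell d q"
      unfolding w fund_cell_def site_def by (force simp del: of_nat_mod)
  next
    fix w assume w: "w \<in> fund_cell d q"
    then have "\<And>j. j < d \<Longrightarrow> nat (w $ j) < q j" by (force simp: fund_cell_def)
    from mixed_radix_exists[of d "\<lambda>j. nat (w $ j)" q, OF this]
    obtain i where i: "i < (\<Prod>j<d. q j)"
      "\<And>j. j < d \<Longrightarrow> i div (\<Prod>l<j. q l) mod q j = nat (w $ j)" by auto
    have "w = site d q i"
      using w i(2) by (intro eq_vecI) (auto simp: site_def fund_cell_def simp del: of_nat_mod)
    then show "w \<in> site d q ` {..<(\<Prod>j<d. q j)}" using i(1) by auto
  qed
qed

lemma floquet_delta_in_space:
  assumes "\<And>j. j < d \<Longrightarrow> q j > 0"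
  shows "floquet_delta d q k w \<in> floquet_space d q k"
  unfolding floquet_space_def
proof (intro CollectI ballI allI impI)
  fix n :: "int vec" and j assume n: "n \<in> carrier_vec d" and j: "j < d"
  let ?n = "n + int (q j) \<cdot>\<^sub>v unit_vec d j"
  have c: "?n $ l = (if l = j then n $ j + int (q j) else n $ l)" if "l < d" for l
    using that n j by simp
  have m: "?n $ l mod int (q l) = n $ l mod int (q l)" if "l < d" for l
    unfolding c[OF that] by simp
  have "(\<Sum>l<d. k l * real_of_int (?n $ l div int (q l))) =
        (\<Sum>l<d. k l * real_of_int (n $ l div int (q l)) + (if l = j then k j else 0))"
  proof (intro sum.cong refl)
    fix l assume "l \<in> {..<d}"
    then have l: "l < d" by simp
    show "k l * real_of_int (?n $ l div int (q l)) =
        k l * real_of_int (n $ l div int (q l)) + (if l = j then k j else 0)"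
      unfolding c[OF l] using assms[OF l] by (auto simp: algebra_simps)
  qed
  also have "\<dots> = (\<Sum>l<d. k l * real_of_int (n $ l div int (q l))) + k j"
    using j by (simp add: sum.distrib)
  finally show "floquet_delta d q k w ?n = cis (2 * pi * k j) * floquet_delta d q k w n"
    unfolding floquet_delta_def using m by (simp add: cis_mult algebra_simps)
qed

lemma floquet_delta_on_cell:
  assumes "w \<in> fund_cell d q" "n \<in> fund_cell d q"
  shows "floquet_delta d q k w n = (if n = w then 1 else 0)"
proof -
  have "n $ j mod int (q j) = n $ j" "n $ j div int (q j) = 0" if "j < d" for j
    using that assms by (auto simp: fund_cell_def)
  then have "(\<forall>j<d. n $ j mod int (q j) = w $ j) \<longleftrightarrow> (\<forall>j<d. n $ j = w $ j)"
    and "(\<Sum>j<d. k j * real_of_int (n $ j div int (q j))) = 0"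
    by (auto intro!: sum.neutral)
  moreover have "n = w \<longleftrightarrow> (\<forall>j<d. n $ j = w $ j)"
    using assms by (auto simp: fund_cell_def)
  ultimately show ?thesis unfolding floquet_delta_def by (simp only: mult_zero_right cis_zero)
qed

lemma floquet_shift:
  assumes u: "u \<in> floquet_space d q k" and n: "n \<in> carrier_vec d" and j: "j < d"
  shows "u (n + (m * int (q j)) \<cdot>\<^sub>v unit_vec d j) = cis (2 * pi * k j * of_int m) * u n"
proof -
  have pos: "u (n + (int p * int (q j)) \<cdot>\<^sub>v unit_vec d j) = cis (2 * pi * k j * real p) * u n"
    if "n \<in> carrier_vec d" for p n
  proof (induction p)
    case 0
    have "n + (int 0 * int (q j)) \<cdot>\<^sub>v unit_vec d j = n"
      using that by (intro eq_vecI) auto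
    then show ?case by simp
  next
    case (Suc p)
    let ?n = "n + (int p * int (q j)) \<cdot>\<^sub>v unit_vec d j"
    have e: "n + (int (Suc p) * int (q j)) \<cdot>\<^sub>v unit_vec d j = ?n + int (q j) \<cdot>\<^sub>v unit_vec d j"
      using that by (intro eq_vecI) (auto simp: algebra_simps)
    have "?n \<in> carrier_vec d" using that by simp
    with u j have "u (?n + int (q j) \<cdot>\<^sub>v unit_vec d j) = cis (2 * pi * k j) * u ?n"
      unfolding floquet_space_def by blast
    also have "\<dots> = cis (2 * pi * k j * real (Suc p)) * u n"
      unfolding Suc mult.assoc[of "cis _" "cis _" "u n", symmetric] cis_mult
      by (simp add: algebra_simps)
    finally show ?case by (simp only: e)
  qed
  show ?thesis
  proof (cases "m \<ge> 0")
    case True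
    with pos[OF n, of "nat m"] show ?thesis by simp
  next
    case False
    define p where "p = nat (- m)"
    have m: "m = - int p" using False by (simp add: p_def)
    let ?n = "n + (m * int (q j)) \<cdot>\<^sub>v unit_vec d j"
    have "?n + (int p * int (q j)) \<cdot>\<^sub>v unit_vec d j = n"
      using n by (intro eq_vecI) (auto simp: m algebra_simps)
    moreover have "?n \<in> carrier_vec d" using n by simp
    ultimately have "u n = cis (2 * pi * k j * real p) * u ?n" using pos[of ?n p] by simp
    then have "cis (2 * pi * k j * of_int m) * u n =
        cis (2 * pi * k j * of_int m) * cis (2 * pi * k j * real p) * u ?n" by simp
    then show ?thesis by (simp add: cis_mult m)
  qed
qed

lemma floquet_reduce:
  assumes u: "u \<in> floquet_space d q k" and n: "n \<in> carrier_vec d"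
  shows "u n = cis (2 * pi * (\<Sum>j<d. k j * real_of_int (n $ j div int (q j)))) *
               u (vec d (\<lambda>l. n $ l mod int (q l)))"
proof -
  let ?red = "\<lambda>e. vec d (\<lambda>l. if l < e then n $ l mod int (q l) else n $ l)"
  have "e \<le> d \<Longrightarrow> u n = cis (2 * pi * (\<Sum>j<e. k j * real_of_int (n $ j div int (q j)))) * u (?red e)"
    for e
  proof (induction e)
    case 0
    have "?red 0 = n" using n by (intro eq_vecI) auto
    then show ?case by simp
  next
    case (Suc e)
    have e: "e < d" using Suc by simp
    have eq: "?red e = ?red (Suc e) + ((n $ e div int (q e)) * int (q e)) \<cdot>\<^sub>v unit_vec d e"
      using n e by (intro eq_vecI) (auto simp: less_Suc_eq)
    have "u (?red e) = cis (2 * pi * k e * of_int (n $ e div int (q e))) * u (?red (Suc e))"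
      unfolding eq by (rule floquet_shift[OF u _ e]) simp
    moreover have "u n = cis (2 * pi * (\<Sum>j<e. k j * real_of_int (n $ j div int (q j)))) * u (?red e)"
      using Suc by simp
    ultimately have "u n = cis (2 * pi * (\<Sum>j<e. k j * real_of_int (n $ j div int (q j)))) *
        cis (2 * pi * k e * of_int (n $ e div int (q e))) * u (?red (Suc e))"
      by (simp only: mult.assoc)
    then show ?case by (simp add: cis_mult distrib_left mult.assoc)
  qed
  from this[of d] have "u n = cis (2 * pi * (\<Sum>j<d. k j * real_of_int (n $ j div int (q j)))) * u (?red d)"
    by simp
  moreover have "?red d = vec d (\<lambda>l. n $ l mod int (q l))" by (intro eq_vecI) auto
  ultimately show ?thesis by simp
qed

lemma floquet_expansion:
  assumes q: "\<And>j. j < d \<Longrightarrow> q j > 0"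
    and u: "u \<in> floquet_space d q k" and n: "n \<in> carrier_vec d"
  shows "u n = (\<Sum>w\<in>fund_cell d q. u w * floquet_delta d q k w n)"
proof -
  let ?w = "vec d (\<lambda>l. n $ l mod int (q l))"
  have w: "?w \<in> fund_cell d q"
    using q by (auto simp: fund_cell_def intro!: pos_mod_sign zle_diff1_eq[THEN iffD2])
  have fin: "finite (fund_cell d q)"
    using bij_betw_finite[OF site_bij_betw[of d q]] q by simp
  have "(\<Sum>w\<in>fund_cell d q. u w * floquet_delta d q k w n) =
        (\<Sum>w\<in>fund_cell d q. if w = ?w then u w * floquet_delta d q k w n else 0)"
  proof (intro sum.cong refl)
    fix w assume "w \<in> fund_cell d q"
    then have "w = ?w \<longleftrightarrow> (\<forall>j<d. n $ j mod int (q j) = w $ j)"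
      by (auto simp: fund_cell_def)
    then show "u w * floquet_delta d q k w n = (if w = ?w then u w * floquet_delta d q k w n else 0)"
      by (auto simp: floquet_delta_def)
  qed
  also have "\<dots> = u ?w * floquet_delta d q k ?w n" using fin w by simp
  also have "\<dots> = u n"
    using floquet_reduce[OF u n] by (simp add: floquet_delta_def mult.commute)
  finally show ?thesis by simp
qed

text \<open>
  \<open>floquet_matrix\<close> is the coordinate matrix of the operator on \<open>floquet_space d q k\<close> with respect
  to the values on the fundamental cell, and for periodic \<open>V\<close> the operator preserves this space.
\<close>

lemma floquet_matrix_represents:
  assumes q: "\<And>j. j < d \<Longrightarrow> q j > 0" and u: "u \<in> floquet_space d q k"
    and a: "a < (\<Prod>j<d. q j)"
  shows "schroedinger d V u (site d q a) =
    (\<Sum>b<(\<Prod>j<d. q j). floquet_matrix d q V k $$ (a, b) * u (site d q b))"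
proof -
  let ?s = "site d q a" and ?W = "fund_cell d q"
  let ?N = "{n' \<in> carrier_vec d. l1_norm (n' - ?s) = 1}"
  have s: "?s \<in> carrier_vec d" by (simp add: site_def)
  have ex: "u n = (\<Sum>w\<in>?W. u w * floquet_delta d q k w n)" if "n \<in> carrier_vec d" for n
    using floquet_expansion[of d q u k n] q u that by blast
  have "laplacian d u ?s = (\<Sum>n'\<in>?N. \<Sum>w\<in>?W. u w * floquet_delta d q k w n')"
    unfolding laplacian_def by (intro sum.cong) (auto intro: ex)
  also have "\<dots> = (\<Sum>w\<in>?W. u w * laplacian d (floquet_delta d q k w) ?s)"
    unfolding laplacian_def sum_distrib_left by (rule sum.swap)
  finally have "schroedinger d V u ?s =
      (\<Sum>w\<in>?W. schroedinger d V (floquet_delta d q k w) ?s * u w)"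
    unfolding schroedinger_def
    by (subst ex[OF s]) (auto simp: sum_distrib_left algebra_simps simp flip: sum.distrib)
  also have "\<dots> = (\<Sum>b<(\<Prod>j<d. q j).
      schroedinger d V (floquet_delta d q k (site d q b)) ?s * u (site d q b))"
    by (rule sum.reindex_bij_betw[OF site_bij_betw[of d q, OF q], symmetric])
  also have "\<dots> = (\<Sum>b<(\<Prod>j<d. q j). floquet_matrix d q V k $$ (a, b) * u (site d q b))"
    using a by (intro sum.cong) (auto simp: floquet_matrix_def)
  finally show ?thesis .
qed

lemma schroedinger_in_floquet_space:
  assumes V: "periodic d q V" and u: "u \<in> floquet_space d q k"
  shows "schroedinger d V u \<in> floquet_space d q k"
  unfolding floquet_space_def
proof (intro CollectI ballI allI impI)
  fix n :: "int vec" and j assume n: "n \<in> carrier_vec d" and j: "j < d"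
  let ?g = "int (q j) \<cdot>\<^sub>v unit_vec d j :: int vec"
  have "?g \<in> period_lattice d q" using j by (auto simp: period_lattice_def)
  then have V': "V (n + ?g) = V n" using V n by (simp add: periodic_def)
  have u': "u (x + ?g) = cis (2 * pi * k j) * u x" if "x \<in> carrier_vec d" for x
    using u j that by (simp add: floquet_space_def)
  have "laplacian d u (n + ?g) =
      (\<Sum>x \<in> {x \<in> carrier_vec d. l1_norm (x - n) = 1}. u (x + ?g))"
    unfolding laplacian_def
  proof (rule sum.reindex_bij_witness[of _ "\<lambda>x. x + ?g" "\<lambda>x. x - ?g"])
    fix x assume x: "x \<in> {n' \<in> carrier_vec d. l1_norm (n' - (n + ?g)) = 1}"
    have "x - ?g - n = x - (n + ?g)" using x n by (intro eq_vecI) auto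
    then show "x - ?g \<in> {x \<in> carrier_vec d. l1_norm (x - n) = 1}" using x by simp
    show "x - ?g + ?g = x" using x by (intro eq_vecI) auto
    then show "u (x - ?g + ?g) = u x" by simp
  next
    fix x assume x: "x \<in> {x \<in> carrier_vec d. l1_norm (x - n) = 1}"
    have "x + ?g - (n + ?g) = x - n" using x n by (intro eq_vecI) auto
    then show "x + ?g \<in> {n' \<in> carrier_vec d. l1_norm (n' - (n + ?g)) = 1}" using x by simp
    show "x + ?g - ?g = x" using x by (intro eq_vecI) auto
  qed
  also have "\<dots> = cis (2 * pi * k j) * laplacian d u n"
    unfolding laplacian_def sum_distrib_left by (intro sum.cong) (auto simp: u')
  finally show "schroedinger d V u (n + ?g) = cis (2 * pi * k j) * schroedinger d V u n"
    by (simp add: schroedinger_def V' u'[OF n] algebra_simps)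
qed

end

theory Submission
  imports Defs "Jordan_Normal_Form.Schur_Decomposition"
begin

text \<open>
  Because the periods are pairwise coprime, the characters of \<open>\<int>\<^sup>d\<close> modulo the period lattice
  are indexed by residues modulo \<open>Q\<close>: the character \<open>chi m\<close> takes the value
  \<open>omega j m = exp (2 \<pi> \<i> m / q j)\<close> on the \<open>j\<close>-th basis vector. Let \<open>coef V m\<close> be the corresponding
  Fourier coefficient. A periodic function is separable if and only if its coefficient
  vanishes at every \<open>l\<close> that is non-trivial in two different blocks, that is, for which neither
  \<open>q s\<close> nor \<open>q t\<close> divides \<open>l\<close> for some \<open>s\<close> and \<open>t\<close> in different blocks (\<open>coef_eq_0_of_mixed_difference\<close>
  with \<open>separable_mixed_difference\<close>, and \<open>separable_if_coef_eq_0\<close>). So it suffices to carry this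
  vanishing from \<open>V\<close> to \<open>Y\<close> for one pair \<open>s\<close>, \<open>t\<close> and one \<open>l\<close>.

  In the basis of Bloch waves the Floquet matrix is a diagonal matrix plus the convolution
  matrix \<open>coef V (i - j)\<close> (\<open>char_det_eq_det_fourier_mat\<close>). With \<open>z j = exp (2 \<pi> \<i> k j / q j)\<close> the
  diagonal entries are \<open>\<Sum>j. omega j i * z j + 1 / (omega j i * z j)\<close>, so the determinant is a
  Laurent polynomial in the \<open>z j\<close>, and isospectrality extends from the torus to all non-zero
  values of three variables \<open>z s\<close>, \<open>z t\<close>, \<open>z w\<close> with \<open>w\<close> a third element of \<open>S\<close>; the others stay fixed.

  Put \<open>a = omega s l\<close>, \<open>b = omega t l\<close>, \<open>c = omega w l\<close>. These are pairwise distinct, and the vector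
  \<open>p = (b - c, c - a, a - b)\<close> is orthogonal to \<open>(1, 1, 1)\<close> and to \<open>(a, b, c)\<close>. Let \<open>z = n p + v\<close> and
  \<open>n \<rightarrow> \<infinity>\<close>. The diagonal entry of row \<open>i\<close> grows linearly unless \<open>omega s i\<close>, \<open>omega t i\<close>, \<open>omega w i\<close>
  pair to zero with \<open>p\<close>, and this happens only if they are \<open>(1, 1, 1)\<close> or \<open>(a, b, c)\<close>
  (\<open>linear_part_eq_0_iff\<close>): they arise from \<open>a\<close>, \<open>b\<close>, \<open>c\<close> by an affine map \<open>x \<mapsto> \<alpha> x + \<beta>\<close>, and such a map
  can send three points of the unit circle to the unit circle only if \<open>\<alpha> = 0\<close> or \<open>\<beta> = 0\<close>; then
  roots of unity of coprime orders agree, hence are \<open>1\<close>. In the limit only the two families of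
  rows \<open>i \<equiv> 0\<close> and \<open>i \<equiv> l\<close> modulo \<open>q s * q t * q w\<close> survive, and the choice of \<open>v\<close> shifts the
  diagonals of the two blocks by independent amounts. Hence, with the blocks weighted by \<open>1\<close> and
  by \<open>\<theta> = \<plusminus>1\<close>, the limit matrices for \<open>V\<close> and \<open>Y\<close> have the same characteristic polynomial
  (\<open>char_poly_resonant_mat_eq\<close>), and the traces of their squares agree. The difference of these
  traces between \<open>\<theta> = 1\<close> and \<open>\<theta> = -1\<close> is a multiple of the sum of \<open>coef V (i - j) * coef V (j - i)\<close>
  over pairs of rows from opposite families: the diagonals, the fixed variables and the
  spectral parameters cancel. For separable \<open>V\<close> this sum is zero. For real \<open>Y\<close> it is a sum of the
  squares \<open>\<bar>coef Y (i - j)\<bar>\<^sup>2\<close>, among them the one with \<open>i - j = l\<close>, so \<open>coef Y l = 0\<close> (\<open>coef_eq_0\<close>).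
\<close>

section \<open>Determinants, traces and the unit circle\<close>

definition trace_sq :: "complex mat \<Rightarrow> complex" where
  "trace_sq A = (\<Sum>i<dim_row A. \<Sum>j<dim_row A. A $$ (i, j) * A $$ (j, i))"

lemma trace_mult_commute:
  fixes A B :: "complex mat"
  assumes A: "A \<in> carrier_mat n n" and B: "B \<in> carrier_mat n n"
  shows "(\<Sum>i<n. (A * B) $$ (i, i)) = (\<Sum>i<n. (B * A) $$ (i, i))"
proof -
  have "(\<Sum>i<n. (A * B) $$ (i, i)) = (\<Sum>i<n. \<Sum>j<n. A $$ (i, j) * B $$ (j, i))"
    using A B by (intro sum.cong refl) (simp add: scalar_prod_def atLeast0LessThan)
  also have "\<dots> = (\<Sum>j<n. \<Sum>i<n. A $$ (i, j) * B $$ (j, i))"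
    by (rule sum.swap)
  also have "\<dots> = (\<Sum>i<n. (B * A) $$ (i, i))"
    using A B by (intro sum.cong refl) (simp add: scalar_prod_def atLeast0LessThan mult.commute)
  finally show ?thesis .
qed

lemma trace_sq_eq_trace:
  assumes A: "A \<in> carrier_mat n n"
  shows "trace_sq A = (\<Sum>i<n. (A * A) $$ (i, i))"
  using A unfolding trace_sq_def
  by (intro sum.cong) (auto simp: scalar_prod_def atLeast0LessThan)

lemma trace_sq_similar:
  assumes "similar_mat A B"
  shows "trace_sq A = trace_sq B"
proof -
  from assms obtain P Q where "similar_mat_wit A B P Q"
    unfolding similar_mat_def by blast
  note w = similar_mat_witD[OF refl this]
  define n where "n = dim_row A"
  note w = w[folded n_def]
  have "A * A = P * (B * B * Q)"
  proof -
    have "A * A = P * B * Q * (P * B * Q)" using w by simp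
    also have "\<dots> = P * B * (Q * P) * B * Q"
      using w(4-7) by (simp add: assoc_mult_mat[of _ n n _ n _ n])
    also have "\<dots> = P * (B * B * Q)"
      using w(2,4-7) by (simp add: assoc_mult_mat[of _ n n _ n _ n])
    finally show ?thesis .
  qed
  then have "trace_sq A = (\<Sum>i<n. (P * (B * B * Q)) $$ (i, i))"
    using trace_sq_eq_trace[OF w(4)] by simp
  also have "\<dots> = (\<Sum>i<n. (B * B * Q * P) $$ (i, i))"
    using w by (intro trace_mult_commute) auto
  also have "B * B * Q * P = B * B"
    using w by (simp add: assoc_mult_mat[of _ n n _ n _ n])
  finally show ?thesis using trace_sq_eq_trace[OF w(5)] by simp
qed

lemma trace_sq_upper_triangular:
  assumes A: "A \<in> carrier_mat n n" and ut: "upper_triangular A"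
  shows "trace_sq A = (\<Sum>a\<leftarrow>diag_mat A. a\<^sup>2)"
proof -
  have "trace_sq A = (\<Sum>i<n. \<Sum>j<n. if i = j then (A $$ (i, i))\<^sup>2 else 0)"
    unfolding trace_sq_def using A ut
    by (intro sum.cong) (auto simp: power2_eq_square upper_triangular_def, metis linorder_neqE_nat)
  also have "\<dots> = (\<Sum>i<n. (A $$ (i, i))\<^sup>2)" by simp
  also have "\<dots> = (\<Sum>a\<leftarrow>diag_mat A. a\<^sup>2)"
    using A by (simp add: diag_mat_def interv_sum_list_conv_sum_set_nat comp_def atLeast0LessThan)
  finally show ?thesis .
qed

text \<open>
  Both matrices are similar to upper triangular ones with the same diagonal, the list of roots of the
  characteristic polynomial, so both traces are the sum of the squares of these roots.
\<close>

lemma trace_sq_char_poly_cong: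
  assumes A: "A \<in> carrier_mat n n" and B: "B \<in> carrier_mat n n"
    and eq: "char_poly A = char_poly B"
  shows "trace_sq A = trace_sq B"
proof -
  from char_poly_factorized[OF A] obtain es where es: "char_poly A = (\<Prod>e\<leftarrow>es. [:- e, 1:])"
    by auto
  have *: "trace_sq C = (\<Sum>a\<leftarrow>es. a\<^sup>2)"
    if C: "C \<in> carrier_mat n n" and cp: "char_poly C = (\<Prod>e\<leftarrow>es. [:- e, 1:])" for C
  proof -
    obtain T P Q where s: "schur_decomposition C es = (T, P, Q)"
      by (cases "schur_decomposition C es") auto
    note sd = schur_decomposition[OF C cp s]
    have sim: "similar_mat C T" using sd unfolding similar_mat_def by blast
    have "n = dim_row C" using C by simp
    have "T \<in> carrier_mat n n"
      using sd similar_mat_witD(5)[OF \<open>n = dim_row C\<close>] by blast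
    then show ?thesis
      using trace_sq_similar[OF sim] trace_sq_upper_triangular[of T n] sd by simp
  qed
  show ?thesis using *[OF A es] *[OF B] es eq by simp
qed

text \<open>
  Two polynomials that agree at infinitely many points are equal. The point \<open>x = 0\<close> is left out because
  \<open>x\<close> also serves as a scaling factor of rows where this is applied, and scaling by zero would lose
  information.
\<close>

lemma char_poly_eqI:
  fixes A B :: "complex mat"
  assumes A: "A \<in> carrier_mat n n" and B: "B \<in> carrier_mat n n"
    and eq: "\<And>x. x \<noteq> 0 \<Longrightarrow> det (x \<cdot>\<^sub>m 1\<^sub>m n + A) = det (x \<cdot>\<^sub>m 1\<^sub>m n + B)"
  shows "char_poly A = char_poly B"
proof (rule ccontr)
  assume ne: "char_poly A \<noteq> char_poly B"
  have cp: "poly (char_poly C) x = (-1) ^ n * det ((- x) \<cdot>\<^sub>m 1\<^sub>m n + C)"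
    if C: "C \<in> carrier_mat n n" for C :: "complex mat" and x
  proof -
    have "poly (char_poly C) x = det (- char_matrix C x)" by (rule char_poly_matrix[OF C])
    also have "- char_matrix C x = (-1) \<cdot>\<^sub>m ((- x) \<cdot>\<^sub>m 1\<^sub>m n + C)"
      using C by (intro eq_matI) (auto simp: char_matrix_def)
    also have "det \<dots> = (-1) ^ n * det ((- x) \<cdot>\<^sub>m 1\<^sub>m n + C)"
      using C by (subst det_smult) simp
    finally show ?thesis .
  qed
  have "UNIV - {0} \<subseteq> {x. poly (char_poly A - char_poly B) x = 0}"
    using eq by (auto simp: cp[OF A] cp[OF B])
  moreover have "finite {x. poly (char_poly A - char_poly B) x = 0}"
    using ne by (intro poly_roots_finite) simp
  moreover have "infinite (UNIV - {0 :: complex})" by (simp add: infinite_UNIV_char_0)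
  ultimately show False using finite_subset by blast
qed

definition laurent_entries :: "nat \<Rightarrow> (complex \<Rightarrow> complex mat) \<Rightarrow> bool" where
  "laurent_entries n M \<longleftrightarrow> (\<exists>\<alpha> \<beta> \<gamma>. \<forall>z. M z = mat n n (\<lambda>(i, j). \<alpha> i j + \<beta> i j * z + \<gamma> i j / z))"

text \<open>
  Multiplying every entry by \<open>z\<close> turns the matrix into one with polynomial entries.
\<close>

lemma laurent_det:
  assumes "laurent_entries n M"
  obtains p where "\<And>z. z \<noteq> 0 \<Longrightarrow> poly p z = z ^ n * det (M z)"
proof -
  from assms obtain \<alpha> \<beta> \<gamma> where
    M: "\<And>z. M z = mat n n (\<lambda>(i, j). \<alpha> i j + \<beta> i j * z + \<gamma> i j / z)"
    unfolding laurent_entries_def by blast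
  let ?P = "mat n n (\<lambda>(i, j). [:\<gamma> i j, \<alpha> i j, \<beta> i j:])"
  have "poly (det ?P) z = z ^ n * det (M z)" if z: "z \<noteq> 0" for z
  proof -
    have "poly (det ?P) z = det (z \<cdot>\<^sub>m M z)"
      using z by (intro poly_det_cong[of _ n]) (auto simp: M field_simps)
    then show ?thesis by (simp add: M)
  qed
  then show ?thesis using that by blast
qed

lemma infinite_unit_circle: "infinite {z :: complex. cmod z = 1}"
proof
  assume fin: "finite {z :: complex. cmod z = 1}"
  have "inj_on cis {0<..<pi}"
    by (auto simp: inj_on_def complex_eq_iff intro: cos_inj_pi)
  moreover have "cis ` {0<..<pi} \<subseteq> {z. cmod z = 1}" by auto
  ultimately have "finite {0<..<pi}" using fin finite_imageD finite_subset by blast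
  then show False using infinite_Ioo[OF pi_gt_zero] by simp
qed

lemma laurent_det_unit_circle:
  assumes M: "laurent_entries n M" and N: "laurent_entries n N"
    and eq: "\<And>z. cmod z = 1 \<Longrightarrow> det (M z) = det (N z)" and z: "z \<noteq> 0"
  shows "det (M z) = det (N z)"
proof -
  obtain p where p: "\<And>z. z \<noteq> 0 \<Longrightarrow> poly p z = z ^ n * det (M z)"
    using laurent_det[OF M] by metis
  obtain r where r: "\<And>z. z \<noteq> 0 \<Longrightarrow> poly r z = z ^ n * det (N z)"
    using laurent_det[OF N] by metis
  have "{z. cmod z = 1} \<subseteq> {z. poly (p - r) z = 0}"
  proof
    fix z assume "z \<in> {z. cmod z = 1}"
    then have "cmod z = 1" "z \<noteq> 0" by auto
    then show "z \<in> {z. poly (p - r) z = 0}" using p r eq by simp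
  qed
  then have "p - r = 0"
    using infinite_unit_circle finite_subset poly_roots_finite by blast
  then have "poly p z = poly r z" by simp
  then show ?thesis using p[OF z] r[OF z] z by simp
qed

text \<open>
  On the unit circle \<open>cnj x = 1 / x\<close>, so the condition \<open>cmod (\<alpha> * x + \<beta>) = 1\<close> becomes a quadratic
  equation for \<open>x\<close> with leading coefficient \<open>\<alpha> * cnj \<beta>\<close>. Three distinct roots force this coefficient
  to vanish.
\<close>

lemma unit_circle_affine_three_points:
  fixes a b c \<alpha> \<beta> :: complex
  assumes abc: "cmod a = 1" "cmod b = 1" "cmod c = 1" "a \<noteq> b" "a \<noteq> c" "b \<noteq> c"
    and img: "cmod (\<alpha> * a + \<beta>) = 1" "cmod (\<alpha> * b + \<beta>) = 1" "cmod (\<alpha> * c + \<beta>) = 1"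
  shows "\<alpha> = 0 \<or> \<beta> = 0"
proof -
  define g where "g = \<alpha> * cnj \<beta>"
  define e where "e = \<alpha> * cnj \<alpha> + \<beta> * cnj \<beta> - 1"
  have quad: "g * x\<^sup>2 + e * x + cnj g = 0"
    if x: "cmod x = 1" and y: "cmod (\<alpha> * x + \<beta>) = 1" for x
  proof -
    have xx: "x * cnj x = 1" using x by (simp add: complex_norm_square[symmetric])
    have "(\<alpha> * x + \<beta>) * (cnj \<alpha> * cnj x + cnj \<beta>) = 1"
      using y complex_norm_square[of "\<alpha> * x + \<beta>"] by simp
    then have "(\<alpha> * x + \<beta>) * (cnj \<alpha> * cnj x + cnj \<beta>) * x = x" by simp
    then have "(\<alpha> * x + \<beta>) * (cnj \<alpha> * (x * cnj x) + cnj \<beta> * x) = x"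
      by (simp only: algebra_simps)
    then show ?thesis unfolding xx by (simp add: g_def e_def algebra_simps power2_eq_square)
  qed
  note qa = quad[OF abc(1) img(1)] and qb = quad[OF abc(2) img(2)] and qc = quad[OF abc(3) img(3)]
  have "(a - x) * (g * (a + x) + e) = (g * a\<^sup>2 + e * a + cnj g) - (g * x\<^sup>2 + e * x + cnj g)" for x
    by (simp add: algebra_simps power2_eq_square)
  from this[of b] this[of c] have "(a - b) * (g * (a + b) + e) = 0" "(a - c) * (g * (a + c) + e) = 0"
    unfolding qa qb qc by simp_all
  then have "g * (a + b) + e = 0" "g * (a + c) + e = 0" using abc by auto
  then have "(g * (a + b) + e) - (g * (a + c) + e) = 0" by simp
  then have "g * (b - c) = 0" by (simp only: algebra_simps) simp
  then show ?thesis using abc by (auto simp: g_def)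
qed

lemma det_scale_rows:
  fixes A :: "'a :: comm_ring_1 mat"
  assumes A: "A \<in> carrier_mat n n"
  shows "det (mat n n (\<lambda>(i, j). r i * A $$ (i, j))) = (\<Prod>i<n. r i) * det A"
proof -
  have "(\<Prod>i = 0..<n. mat n n (\<lambda>(i, j). r i * A $$ (i, j)) $$ (i, p i)) =
      (\<Prod>i<n. r i) * (\<Prod>i = 0..<n. A $$ (i, p i))" if "p permutes {0..<n}" for p
    using permutes_in_image[OF that] by (simp add: prod.distrib atLeast0LessThan)
  then show ?thesis
    unfolding det_def'[OF A] det_def'[OF mat_carrier] sum_distrib_left
    by (intro sum.cong) (auto simp: algebra_simps)
qed

lemma tendsto_det:
  fixes A :: "'b \<Rightarrow> complex mat"
  assumes A: "\<And>x. A x \<in> carrier_mat n n" and L: "L \<in> carrier_mat n n"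
    and lim: "\<And>i j. i < n \<Longrightarrow> j < n \<Longrightarrow> ((\<lambda>x. A x $$ (i, j)) \<longlongrightarrow> L $$ (i, j)) F"
  shows "((\<lambda>x. det (A x)) \<longlongrightarrow> det L) F"
  unfolding det_def'[OF A] det_def'[OF L]
  by (intro tendsto_sum tendsto_mult tendsto_const tendsto_prod lim)
    (auto simp: permutes_in_image[of _ "{0..<n}"] dest: permutes_in_image)

lemma tendsto_inverse_linear:
  assumes "p \<noteq> 0" "v \<noteq> 0"
  shows "(\<lambda>n. 1 / (v * (of_nat n * p + x))) \<longlonglongrightarrow> (0 :: complex)"
proof -
  have "filterlim (\<lambda>n. (v * p) * of_nat n) at_infinity sequentially"
    using assms by (intro tendsto_mult_filterlim_at_infinity[OF tendsto_const _ tendsto_of_nat]) auto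
  then have "filterlim (\<lambda>n. v * x + (v * p) * of_nat n) at_infinity sequentially"
    by (intro tendsto_add_filterlim_at_infinity[OF tendsto_const])
  then have "((\<lambda>n. inverse (v * x + (v * p) * of_nat n)) \<longlongrightarrow> 0) sequentially"
    by (rule tendsto_inverse_0[THEN filterlim_compose])
  moreover have "inverse (v * x + (v * p) * of_nat n) = 1 / (v * (of_nat n * p + x))" for n
    by (simp add: algebra_simps inverse_eq_divide)
  ultimately show ?thesis by simp
qed

lemma cis_2pi_eq_1_iff: "cis (2 * pi * x) = 1 \<longleftrightarrow> x \<in> \<int>"
proof
  assume "cis (2 * pi * x) = 1"
  then have "cos (2 * pi * x) = 1" by (metis cis.simps(1) one_complex.simps(1))
  then obtain m :: int where "2 * pi * x = of_int m * 2 * pi"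
    unfolding cos_one_2pi_int by auto
  then have "x = of_int m" by simp
  then show "x \<in> \<int>" by simp
qed (rule cis_multiple_2pi)

section \<open>Characters of the period lattice\<close>

locale coprime_periods =
  fixes d :: nat and q :: "nat \<Rightarrow> nat"
  assumes q_pos: "j < d \<Longrightarrow> q j > 0"
    and q_coprime: "i < d \<Longrightarrow> j < d \<Longrightarrow> i \<noteq> j \<Longrightarrow> coprime (q i) (q j)"
begin

abbreviation Q :: nat where "Q \<equiv> \<Prod>j<d. q j"

definition omega :: "nat \<Rightarrow> int \<Rightarrow> complex" where
  "omega j m = cis (2 * pi * of_int m / real (q j))"

text \<open>
  The Bloch wave with quasimomentum \<open>k\<close> and Fourier mode \<open>m\<close>. One integer \<open>m\<close>, read modulo each
  \<open>q j\<close>, replaces the usual vector of modes by the Chinese remainder theorem.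
\<close>

definition bloch :: "(nat \<Rightarrow> real) \<Rightarrow> int \<Rightarrow> int vec \<Rightarrow> complex" where
  "bloch k m x = cis (2 * pi * (\<Sum>j<d. (k j + of_int m) * of_int (x $ j) / real (q j)))"

definition chi :: "int \<Rightarrow> int vec \<Rightarrow> complex" where
  "chi m x = bloch (\<lambda>_. 0) m x"

lemma Q_pos: "Q > 0"
  using q_pos by (intro prod_pos) auto

lemma norm_omega [simp]: "cmod (omega j m) = 1"
  by (simp add: omega_def)

lemma omega_nonzero [simp]: "omega j m \<noteq> 0"
  by (simp add: omega_def)

lemma omega_eq_1_iff:
  assumes "j < d"
  shows "omega j m = 1 \<longleftrightarrow> int (q j) dvd m"
proof -
  have "omega j m = 1 \<longleftrightarrow> of_int m / real (q j) \<in> \<int>"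
    unfolding omega_def using cis_2pi_eq_1_iff[of "of_int m / real (q j)"] by simp
  also have "\<dots> \<longleftrightarrow> int (q j) dvd m"
  proof
    assume "of_int m / real (q j) \<in> \<int>"
    then obtain c where "of_int m / real (q j) = of_int c" by (rule Ints_cases)
    then have "real_of_int m = of_int (int (q j) * c)" using q_pos[OF assms] by (simp add: field_simps)
    then have "m = int (q j) * c" by (simp only: of_int_eq_iff)
    then show "int (q j) dvd m" by simp
  next
    assume "int (q j) dvd m"
    then obtain c where "m = int (q j) * c" by auto
    then show "of_int m / real (q j) \<in> \<int>" using q_pos[OF assms] by simp
  qed
  finally show ?thesis .
qed

lemma omega_diff: "omega j (m - n) = omega j m / omega j n"
  by (simp add: omega_def cis_divide diff_divide_distrib algebra_simps)

lemma omega_eq_iff: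
  assumes "j < d"
  shows "omega j m = omega j n \<longleftrightarrow> int (q j) dvd m - n"
  using omega_eq_1_iff[OF assms, of "m - n"] by (simp add: omega_diff)

text \<open>
  A common value is a root of unity of two coprime orders, hence \<open>1\<close>.
\<close>

lemma omega_coprime:
  assumes "i < d" "j < d" "i \<noteq> j" and eq: "omega i m = omega j n"
  shows "int (q i) dvd m" "int (q j) dvd n"
proof -
  have pw: "omega l p ^ q l = 1" if "l < d" for l p
  proof -
    have "omega l p ^ q l = cis (real (q l) * (2 * pi * of_int p / real (q l)))"
      unfolding omega_def by (rule DeMoivre)
    also have "\<dots> = cis (2 * pi * of_int p)" using q_pos[OF that] by simp
    finally show ?thesis by (simp add: cis_multiple_2pi)
  qed
  have co: "coprime (q i) (q j)" using q_coprime assms by simp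
  have "omega i m = 1"
  proof -
    from bezout_nat[of "q i" "q j"] q_pos[OF assms(1)] co
    obtain x y where xy: "q i * x = q j * y + 1" by auto
    have "1 = omega i m ^ (q i * x)" using pw[OF assms(1)] by (simp add: power_mult)
    also have "\<dots> = omega j n ^ (q j * y) * omega i m" unfolding xy by (simp add: eq)
    also have "\<dots> = omega i m" using pw[OF assms(2)] by (simp add: power_mult)
    finally show ?thesis by simp
  qed
  then show "int (q i) dvd m" "int (q j) dvd n"
    using omega_eq_1_iff[OF assms(1), of m] omega_eq_1_iff[OF assms(2), of n] eq by simp_all
qed

lemma bloch_add:
  assumes "x \<in> carrier_vec d" "y \<in> carrier_vec d"
  shows "bloch k m (x + y) = bloch k m x * bloch k m y"
proof -
  have "(\<Sum>j<d. (k j + of_int m) * of_int ((x + y) $ j) / real (q j)) =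
      (\<Sum>j<d. (k j + of_int m) * of_int (x $ j) / real (q j)) +
      (\<Sum>j<d. (k j + of_int m) * of_int (y $ j) / real (q j))"
    unfolding sum.distrib[symmetric] using assms
    by (intro sum.cong) (auto simp: distrib_left add_divide_distrib)
  then show ?thesis by (simp add: bloch_def cis_mult distrib_left)
qed

lemma bloch_unit_vec:
  assumes "j < d"
  shows "bloch k m (c \<cdot>\<^sub>v unit_vec d j) = cis (2 * pi * ((k j + of_int m) * of_int c / real (q j)))"
proof -
  have "(\<Sum>l<d. (k l + of_int m) * of_int ((c \<cdot>\<^sub>v unit_vec d j) $ l) / real (q l)) =
      (\<Sum>l<d. if l = j then (k j + of_int m) * of_int c / real (q j) else 0)"
    using assms by (intro sum.cong) auto
  also have "\<dots> = (k j + of_int m) * of_int c / real (q j)" using assms by simp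
  finally show ?thesis by (simp add: bloch_def)
qed

lemma bloch_cnj_mult: "cnj (bloch k m x) * bloch k n x = chi (n - m) x"
  unfolding chi_def bloch_def cis_cnj cis_mult
  by (simp add: algebra_simps sum_distrib_left add_divide_distrib diff_divide_distrib sum.distrib sum_subtractf)

lemma bloch_in_floquet_space: "bloch k m \<in> floquet_space d q k"
  unfolding floquet_space_def
proof (intro CollectI ballI allI impI)
  fix n :: "int vec" and j assume n: "n \<in> carrier_vec d" and j: "j < d"
  have "cis (2 * pi * ((k j + of_int m) * of_int (int (q j)) / real (q j))) = cis (2 * pi * (k j + of_int m))"
    using q_pos[OF j] by simp
  also have "\<dots> = cis (2 * pi * k j) * cis (2 * pi * of_int m)"
    by (simp add: cis_mult algebra_simps)
  finally show "bloch k m (n + int (q j) \<cdot>\<^sub>v unit_vec d j) = cis (2 * pi * k j) * bloch k m n"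
    using n j by (simp add: bloch_add bloch_unit_vec cis_multiple_2pi)
qed

lemma chi_add:
  assumes "x \<in> carrier_vec d" "y \<in> carrier_vec d"
  shows "chi m (x + y) = chi m x * chi m y"
  unfolding chi_def by (rule bloch_add[OF assms])

lemma chi_unit_vec:
  assumes "j < d"
  shows "chi m (unit_vec d j) = omega j m"
proof -
  have "unit_vec d j = 1 \<cdot>\<^sub>v (unit_vec d j :: int vec)" by (intro eq_vecI) auto
  then show ?thesis
    using bloch_unit_vec[OF assms, of "\<lambda>_. 0" m 1] by (simp add: chi_def omega_def)
qed

lemma chi_cnj_mult: "cnj (chi m x) * chi n x = chi (n - m) x"
  unfolding chi_def[of m] chi_def[of n] by (rule bloch_cnj_mult)

lemma chi_minus: "chi (- m) x = cnj (chi m x)"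
  using chi_cnj_mult[of m x 0] by (simp add: chi_def bloch_def)

lemma chi_prod: "x \<in> carrier_vec d \<Longrightarrow> chi m x = (\<Prod>j<d. omega j (m * x $ j))"
proof -
  have cis_sum: "cis (\<Sum>j\<in>A. f j) = (\<Prod>j\<in>A. cis (f j))" if "finite A" for A :: "nat set" and f
    using that by (induction A) (auto simp flip: cis_mult)
  show ?thesis unfolding chi_def bloch_def omega_def sum_distrib_left
    by (subst cis_sum) (simp_all add: algebra_simps)
qed

lemma chi_period_lattice:
  assumes "x \<in> period_lattice d q"
  shows "chi m x = 1"
proof -
  have "x \<in> carrier_vec d" "\<And>j. j < d \<Longrightarrow> int (q j) dvd x $ j"
    using assms by (auto simp: period_lattice_def)
  then show ?thesis by (auto simp: chi_prod omega_eq_1_iff intro!: prod.neutral)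
qed

lemma periodic_chi: "periodic d q (chi m)"
  unfolding periodic_def
proof (intro ballI)
  fix n \<gamma> :: "int vec" assume n: "n \<in> carrier_vec d" and g: "\<gamma> \<in> period_lattice d q"
  then have "\<gamma> \<in> carrier_vec d" by (simp add: period_lattice_def)
  then show "chi m (n + \<gamma>) = chi m n" using n by (simp add: chi_add chi_period_lattice[OF g])
qed

definition cell_reduce :: "int vec \<Rightarrow> int vec" where
  "cell_reduce x = vec d (\<lambda>j. x $ j mod int (q j))"

lemma cell_reduce_in_cell: "cell_reduce x \<in> fund_cell d q"
  using q_pos by (auto simp: fund_cell_def cell_reduce_def intro!: pos_mod_sign zle_diff1_eq[THEN iffD2])

lemma fund_cell_carrier: "x \<in> fund_cell d q \<Longrightarrow> x \<in> carrier_vec d"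
  by (simp add: fund_cell_def)

lemma card_fund_cell: "card (fund_cell d q) = Q"
  using bij_betw_same_card[OF site_bij_betw[of d q]] q_pos by simp

lemma periodic_cell_reduce:
  assumes f: "periodic d q f" and x: "x \<in> carrier_vec d"
  shows "f (cell_reduce x) = f x"
proof -
  let ?g = "x - cell_reduce x"
  have c: "cell_reduce x \<in> carrier_vec d" by (simp add: cell_reduce_def)
  have "?g \<in> period_lattice d q"
    using x by (auto simp: period_lattice_def cell_reduce_def minus_mod_eq_mult_div)
  then have "f (cell_reduce x + ?g) = f (cell_reduce x)"
    using f c by (simp add: periodic_def)
  also have "cell_reduce x + ?g = x" using x c by (intro eq_vecI) auto
  finally show ?thesis by simp
qed

text \<open>
  The shifted cell is again a set of representatives modulo the period lattice.
\<close>

lemma sum_fund_cell_shift: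
  assumes f: "periodic d q f" and y: "y \<in> carrier_vec d"
  shows "(\<Sum>x\<in>fund_cell d q. f (x + y)) = (\<Sum>x\<in>fund_cell d q. f x)"
proof (rule sum.reindex_bij_witness[of _ "\<lambda>x. cell_reduce (x - y)" "\<lambda>x. cell_reduce (x + y)"])
  fix x assume x: "x \<in> fund_cell d q"
  note xc = fund_cell_carrier[OF x]
  have eqI: "cell_reduce u = x" if "u \<in> carrier_vec d" "\<And>j. j < d \<Longrightarrow> u $ j mod int (q j) = x $ j mod int (q j)" for u
    using that x by (intro eq_vecI) (auto simp: cell_reduce_def fund_cell_def)
  show "cell_reduce (cell_reduce (x + y) - y) = x"
    using xc y by (intro eqI) (auto simp: cell_reduce_def mod_diff_left_eq)
  show "cell_reduce (cell_reduce (x - y) + y) = x"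
    using xc y by (intro eqI) (auto simp: cell_reduce_def mod_add_left_eq)
  show "f (cell_reduce (x + y)) = f (x + y)"
    using periodic_cell_reduce[OF f] xc y by simp
qed (rule cell_reduce_in_cell)+

text \<open>
  This is where coprimality makes the single index \<open>m\<close> sufficient: the residues modulo the \<open>q j\<close>
  determine the residue modulo \<open>Q\<close>.
\<close>

lemma Q_dvd_iff: "int Q dvd m \<longleftrightarrow> (\<forall>j<d. int (q j) dvd m)"
proof
  assume "int Q dvd m"
  moreover have "int (q j) dvd int Q" if "j < d" for j
    unfolding int_dvd_int_iff using that by (intro dvd_prodI) auto
  ultimately show "\<forall>j<d. int (q j) dvd m" using dvd_trans by blast
next
  assume *: "\<forall>j<d. int (q j) dvd m"
  have "e \<le> d \<Longrightarrow> int (\<Prod>j<e. q j) dvd m" for e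
  proof (induction e)
    case (Suc e)
    have "coprime (\<Prod>j<e. q j) (q e)"
      using Suc.prems q_coprime by (intro prod_coprime_left) auto
    then have "coprime (int (\<Prod>j<e. q j)) (int (q e))" by (simp only: coprime_int_iff)
    moreover have "int (\<Prod>j<e. q j) dvd m" "int (q e) dvd m" using Suc * by auto
    ultimately have "int (\<Prod>j<e. q j) * int (q e) dvd m" by (intro divides_mult)
    then show ?case by simp
  qed simp
  then show "int Q dvd m" by blast
qed

text \<open>
  If \<open>Q\<close> does not divide \<open>m\<close>, some \<open>q j\<close> does not, and the shift by the \<open>j\<close>-th basis vector multiplies
  the sum by \<open>omega j m \<noteq> 1\<close> although it leaves the sum unchanged.
\<close>

lemma sum_chi: "(\<Sum>x\<in>fund_cell d q. chi m x) = (if int Q dvd m then of_nat Q else 0)"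
proof (cases "int Q dvd m")
  case True
  then have "chi m x = 1" if "x \<in> fund_cell d q" for x
    using fund_cell_carrier[OF that] Q_dvd_iff
    by (auto simp: chi_prod omega_eq_1_iff simp del: of_nat_prod intro!: prod.neutral)
  then show ?thesis using True by (simp add: card_fund_cell)
next
  case False
  then obtain j where j: "j < d" "\<not> int (q j) dvd m" unfolding Q_dvd_iff by blast
  let ?T = "\<Sum>x\<in>fund_cell d q. chi m x"
  have "?T = (\<Sum>x\<in>fund_cell d q. chi m (x + unit_vec d j))"
    by (rule sum_fund_cell_shift[symmetric]) (auto intro: periodic_chi)
  also have "\<dots> = (\<Sum>x\<in>fund_cell d q. omega j m * chi m x)"
    using j by (intro sum.cong) (auto simp: chi_add chi_unit_vec fund_cell_carrier)
  also have "\<dots> = omega j m * ?T" by (simp add: sum_distrib_left)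
  finally have "(1 - omega j m) * ?T = 0" by (simp add: algebra_simps)
  then show ?thesis using False j omega_eq_1_iff by auto
qed

lemma sum_site: "(\<Sum>a<Q. f (site d q a)) = (\<Sum>x\<in>fund_cell d q. f x)"
  by (rule sum.reindex_bij_betw[OF site_bij_betw]) (rule q_pos)

lemma site_carrier [simp]: "site d q a \<in> carrier_vec d"
  by (simp add: site_def)

definition coef :: "(int vec \<Rightarrow> complex) \<Rightarrow> int \<Rightarrow> complex" where
  "coef V m = (\<Sum>x\<in>fund_cell d q. V x * chi (- m) x) / of_nat Q"

lemma Q_dvd_diff: "a < Q \<Longrightarrow> b < Q \<Longrightarrow> int Q dvd int a - int b \<longleftrightarrow> a = b"
  by (metis mod_eq_dvd_iff mod_less of_nat_eq_iff of_nat_mod)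

definition bloch_mat :: "(nat \<Rightarrow> real) \<Rightarrow> complex mat" where
  "bloch_mat k = mat Q Q (\<lambda>(a, i). bloch k (int i) (site d q a))"

definition bloch_mat_adj :: "(nat \<Rightarrow> real) \<Rightarrow> complex mat" where
  "bloch_mat_adj k = mat Q Q (\<lambda>(i, a). cnj (bloch k (int i) (site d q a)))"

lemma bloch_mat_orthogonal: "bloch_mat_adj k * bloch_mat k = of_nat Q \<cdot>\<^sub>m 1\<^sub>m Q"
proof (rule eq_matI)
  fix i j assume "i < dim_row (of_nat Q \<cdot>\<^sub>m 1\<^sub>m Q :: complex mat)" "j < dim_col (of_nat Q \<cdot>\<^sub>m 1\<^sub>m Q :: complex mat)"
  then have ij: "i < Q" "j < Q" by auto
  have "(bloch_mat_adj k * bloch_mat k) $$ (i, j) = (\<Sum>a<Q. chi (int j - int i) (site d q a))"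
    using ij by (simp add: bloch_mat_def bloch_mat_adj_def scalar_prod_def bloch_cnj_mult atLeast0LessThan)
  also have "\<dots> = (\<Sum>x\<in>fund_cell d q. chi (int j - int i) x)" by (rule sum_site)
  also have "\<dots> = (of_nat Q \<cdot>\<^sub>m 1\<^sub>m Q) $$ (i, j)"
    using ij by (auto simp: sum_chi Q_dvd_diff simp del: of_nat_prod)
  finally show "(bloch_mat_adj k * bloch_mat k) $$ (i, j) = (of_nat Q \<cdot>\<^sub>m 1\<^sub>m Q) $$ (i, j)" .
qed (auto simp: bloch_mat_def bloch_mat_adj_def)

end

section \<open>The Floquet matrix in Fourier coordinates\<close>

lemma l1_norm_eq_1_iff:
  fixes x :: "int vec"
  assumes x: "x \<in> carrier_vec d"
  shows "l1_norm x = 1 \<longleftrightarrow> (\<exists>j<d. \<exists>s\<in>{1, -1}. x = s \<cdot>\<^sub>v unit_vec d j)"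
proof
  assume "l1_norm x = 1"
  then have sum1: "(\<Sum>l<d. \<bar>x $ l\<bar>) = 1" using x by (simp add: l1_norm_def)
  then obtain j where j: "j < d" "x $ j \<noteq> 0"
    by (metis (no_types, lifting) abs_0 lessThan_iff sum.neutral zero_neq_one)
  have split: "(\<Sum>l<d. \<bar>x $ l\<bar>) = \<bar>x $ j\<bar> + (\<Sum>l\<in>{..<d} - {j}. \<bar>x $ l\<bar>)"
    using j by (simp add: sum.remove)
  have ge: "(\<Sum>l\<in>{..<d} - {j}. \<bar>x $ l\<bar>) \<ge> 0" by (intro sum_nonneg) auto
  have xj: "\<bar>x $ j\<bar> = 1" and "(\<Sum>l\<in>{..<d} - {j}. \<bar>x $ l\<bar>) = 0"
    using split ge sum1 j by linarith+
  then have other: "x $ l = 0" if "l < d" "l \<noteq> j" for l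
    using that by (subst (asm) sum_nonneg_eq_0_iff) auto
  have "x = (x $ j) \<cdot>\<^sub>v unit_vec d j"
    using x j other by (intro eq_vecI) auto
  moreover have "x $ j \<in> {1, -1}" using xj by auto
  ultimately show "\<exists>j<d. \<exists>s\<in>{1, -1}. x = s \<cdot>\<^sub>v unit_vec d j" using j by blast
next
  assume "\<exists>j<d. \<exists>s\<in>{1, -1}. x = s \<cdot>\<^sub>v unit_vec d j"
  then obtain j s where j: "j < d" and s: "s \<in> {1, -1}" and xs: "x = s \<cdot>\<^sub>v unit_vec d j" by blast
  have "l1_norm x = (\<Sum>l<d. if l = j then 1 else 0)"
    unfolding l1_norm_def xs using j s by (intro sum.cong) auto
  also have "\<dots> = 1" using j by simp
  finally show "l1_norm x = 1" .
qed

lemma laplacian_eq_sum: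
  assumes n: "n \<in> carrier_vec d"
  shows "laplacian d u n = (\<Sum>j<d. u (n + 1 \<cdot>\<^sub>v unit_vec d j) + u (n + (- 1) \<cdot>\<^sub>v unit_vec d j))"
proof -
  let ?f = "\<lambda>(j, s). n + s \<cdot>\<^sub>v unit_vec d j :: int vec"
  have inj: "inj_on ?f ({..<d} \<times> {1, -1})"
  proof (rule inj_onI)
    fix p p' :: "nat \<times> int"
    assume p: "p \<in> {..<d} \<times> {1, -1}" "p' \<in> {..<d} \<times> {1, -1}" and eq: "?f p = ?f p'"
    obtain i s i' s' where ps: "p = (i, s)" "p' = (i', s')" by (cases p, cases p')
    have "?f p $ i = ?f p' $ i" by (simp only: eq)
    then have "s = (if i = i' then s' else 0)" using p n by (auto simp: ps split: if_splits)
    then show "p = p'" using p by (auto simp: ps split: if_splits)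
  qed
  have "{n' \<in> carrier_vec d. l1_norm (n' - n) = 1} = ?f ` ({..<d} \<times> {1, -1})"
  proof (intro equalityI subsetI)
    fix x assume "x \<in> {n' \<in> carrier_vec d. l1_norm (n' - n) = 1}"
    then have x: "x \<in> carrier_vec d" "l1_norm (x - n) = 1" by auto
    then obtain j s where js: "j < d" "s \<in> {1, -1}" "x - n = s \<cdot>\<^sub>v unit_vec d j"
      using l1_norm_eq_1_iff[of "x - n" d] n by (meson minus_carrier_vec)
    have "x = n + (x - n)" using x n by (intro eq_vecI) auto
    then have "x = ?f (j, s)" using js(3) by simp
    then show "x \<in> ?f ` ({..<d} \<times> {1, -1})" using js by blast
  next
    fix x assume "x \<in> ?f ` ({..<d} \<times> {1, -1})"
    then obtain j s where js: "j < d" "s \<in> {1, -1}" "x = n + s \<cdot>\<^sub>v unit_vec d j" by auto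
    have "x - n = s \<cdot>\<^sub>v unit_vec d j" using n js by (intro eq_vecI) auto
    then have "l1_norm (x - n) = 1" using l1_norm_eq_1_iff[of "x - n" d] js by auto
    then show "x \<in> {n' \<in> carrier_vec d. l1_norm (n' - n) = 1}" using n js by simp
  qed
  then have "laplacian d u n = (\<Sum>p\<in>{..<d} \<times> {1, -1}. u (?f p))"
    unfolding laplacian_def by (simp add: sum.reindex[OF inj])
  also have "\<dots> = (\<Sum>j<d. \<Sum>s\<in>{1, -1}. u (?f (j, s)))"
    by (subst sum.cartesian_product) (simp add: case_prod_unfold)
  finally show ?thesis by simp
qed

context coprime_periods
begin

lemma of_nat_Q_nonzero: "(of_nat Q :: complex) \<noteq> 0"
  using Q_pos by (metis of_nat_eq_0_iff less_numeral_extra(3))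

text \<open>
  The eigenvalue of the Laplacian on a Bloch wave with mode \<open>m\<close>, as a function of the complex
  variables \<open>z j\<close> that take the place of \<open>exp (2 \<pi> \<i> k j / q j)\<close>.
\<close>

definition dispersion :: "(nat \<Rightarrow> complex) \<Rightarrow> int \<Rightarrow> complex" where
  "dispersion z m = (\<Sum>j<d. omega j m * z j + 1 / (omega j m * z j))"

definition fourier_mat :: "(int vec \<Rightarrow> complex) \<Rightarrow> complex \<Rightarrow> (nat \<Rightarrow> complex) \<Rightarrow> complex mat" where
  "fourier_mat V c z = mat Q Q (\<lambda>(i, j).
     (if i = j then dispersion z (int i) - c else 0) + coef V (int i - int j))"

lemma laplacian_bloch:
  assumes n: "n \<in> carrier_vec d"
  shows "laplacian d (bloch k m) n =
    dispersion (\<lambda>j. cis (2 * pi * k j / real (q j))) m * bloch k m n"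
proof -
  have p: "cis (2 * pi * ((k j + of_int m) * of_int 1 / real (q j))) =
      omega j m * cis (2 * pi * k j / real (q j))" for j
    by (simp add: omega_def cis_mult add_divide_distrib algebra_simps)
  have q: "cis (2 * pi * ((k j + of_int m) * of_int (- 1) / real (q j))) =
      1 / (omega j m * cis (2 * pi * k j / real (q j)))" for j
  proof -
    have "cis (2 * pi * ((k j + of_int m) * of_int (- 1) / real (q j))) =
        inverse (cis (2 * pi * ((k j + of_int m) * of_int 1 / real (q j))))"
      unfolding cis_inverse by (rule arg_cong[of _ _ cis]) (simp add: divide_inverse algebra_simps)
    also have "\<dots> = 1 / (omega j m * cis (2 * pi * k j / real (q j)))"
      unfolding p inverse_eq_divide ..
    finally show ?thesis .
  qed
  have "bloch k m (n + 1 \<cdot>\<^sub>v unit_vec d j) + bloch k m (n + (- 1) \<cdot>\<^sub>v unit_vec d j) =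
      (omega j m * cis (2 * pi * k j / real (q j)) + 1 / (omega j m * cis (2 * pi * k j / real (q j)))) *
      bloch k m n" if j: "j < d" for j
  proof -
    have shift: "bloch k m (n + s \<cdot>\<^sub>v unit_vec d j) = bloch k m n * bloch k m (s \<cdot>\<^sub>v unit_vec d j)" for s
      using n by (simp add: bloch_add)
    show ?thesis
      unfolding shift bloch_unit_vec[OF j] p q by (simp only: distrib_left distrib_right mult.commute)
  qed
  then show ?thesis
    unfolding laplacian_eq_sum[OF n] dispersion_def sum_distrib_right
    by (intro sum.cong) auto
qed

text \<open>
  Conjugation by the matrix of Bloch waves, which is unitary up to the factor \<open>sqrt Q\<close>: the Laplacian
  becomes diagonal and multiplication by \<open>V\<close> becomes convolution with its Fourier coefficients.
\<close>

lemma char_det_eq_det_fourier_mat: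
  "char_det d q V k c = det (fourier_mat V c (\<lambda>j. cis (2 * pi * k j / real (q j))))"
proof -
  let ?z = "\<lambda>j. cis (2 * pi * k j / real (q j))"
  let ?M = "floquet_matrix d q V k - c \<cdot>\<^sub>m 1\<^sub>m Q"
  let ?U = "bloch_mat k" and ?U' = "bloch_mat_adj k"
  have car [simp]: "?M \<in> carrier_mat Q Q" "?U \<in> carrier_mat Q Q" "?U' \<in> carrier_mat Q Q"
    by (auto simp: floquet_matrix_def bloch_mat_def bloch_mat_adj_def)
  have MU: "(?M * ?U) $$ (a, i) =
      (dispersion ?z (int i) + V (site d q a) - c) * bloch k (int i) (site d q a)"
    if a: "a < Q" and i: "i < Q" for a i
  proof -
    have "(?M * ?U) $$ (a, i) = (\<Sum>b<Q. (floquet_matrix d q V k $$ (a, b) - (if a = b then c else 0)) *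
        bloch k (int i) (site d q b))"
      using a i by (simp add: scalar_prod_def bloch_mat_def floquet_matrix_def atLeast0LessThan)
        (auto intro!: sum.cong)
    also have "\<dots> = (\<Sum>b<Q. floquet_matrix d q V k $$ (a, b) * bloch k (int i) (site d q b))
        - (\<Sum>b<Q. if a = b then c * bloch k (int i) (site d q b) else 0)"
      unfolding sum_subtractf[symmetric] by (intro sum.cong) (auto simp: left_diff_distrib)
    also have "(\<Sum>b<Q. floquet_matrix d q V k $$ (a, b) * bloch k (int i) (site d q b)) =
        schroedinger d V (bloch k (int i)) (site d q a)"
      by (rule floquet_matrix_represents[OF q_pos bloch_in_floquet_space a, symmetric])
    also have "\<dots> = (dispersion ?z (int i) + V (site d q a)) * bloch k (int i) (site d q a)"
      by (simp add: schroedinger_def laplacian_bloch distrib_right)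
    finally show ?thesis using a by (simp add: algebra_simps)
  qed
  have "?U' * (?M * ?U) = of_nat Q \<cdot>\<^sub>m fourier_mat V c ?z"
  proof (rule eq_matI)
    fix i j assume "i < dim_row (of_nat Q \<cdot>\<^sub>m fourier_mat V c ?z)" "j < dim_col (of_nat Q \<cdot>\<^sub>m fourier_mat V c ?z)"
    then have ij: "i < Q" "j < Q" by (auto simp: fourier_mat_def)
    have dims: "dim_row (?M * ?U) = Q" "dim_col (?M * ?U) = Q"
      by (simp_all add: bloch_mat_def)
    have "(?U' * (?M * ?U)) $$ (i, j) =
        (\<Sum>a<Q. cnj (bloch k (int i) (site d q a)) * (?M * ?U) $$ (a, j))"
      using ij dims unfolding times_mat_def[of ?U']
      by (simp add: bloch_mat_adj_def scalar_prod_def atLeast0LessThan del: index_mult_mat)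
    also have "\<dots> = (\<Sum>a<Q. (dispersion ?z (int j) - c) * chi (int j - int i) (site d q a) +
        V (site d q a) * chi (- (int i - int j)) (site d q a))"
    proof (intro sum.cong refl)
      fix a assume "a \<in> {..<Q}"
      then have "a < Q" by simp
      have "cnj (bloch k (int i) (site d q a)) * (?M * ?U) $$ (a, j) =
          (dispersion ?z (int j) - c + V (site d q a)) *
          (cnj (bloch k (int i) (site d q a)) * bloch k (int j) (site d q a))"
        unfolding MU[OF \<open>a < Q\<close> ij(2)] by (simp add: algebra_simps)
      then show "cnj (bloch k (int i) (site d q a)) * (?M * ?U) $$ (a, j) =
          (dispersion ?z (int j) - c) * chi (int j - int i) (site d q a) +
          V (site d q a) * chi (- (int i - int j)) (site d q a)"
        unfolding bloch_cnj_mult by (simp add: distrib_right)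
    qed
    also have "\<dots> = (dispersion ?z (int j) - c) * (\<Sum>x\<in>fund_cell d q. chi (int j - int i) x) +
        (\<Sum>x\<in>fund_cell d q. V x * chi (- (int i - int j)) x)"
      by (simp only: sum.distrib sum_distrib_left[symmetric] sum_site[of "\<lambda>x. chi (int j - int i) x"]
          sum_site[of "\<lambda>x. V x * chi (- (int i - int j)) x"])
    also have "\<dots> = (of_nat Q \<cdot>\<^sub>m fourier_mat V c ?z) $$ (i, j)"
      using ij Q_pos
      by (auto simp: sum_chi Q_dvd_diff fourier_mat_def coef_def algebra_simps simp del: of_nat_prod)
    finally show "(?U' * (?M * ?U)) $$ (i, j) = (of_nat Q \<cdot>\<^sub>m fourier_mat V c ?z) $$ (i, j)" .
  qed (auto simp: fourier_mat_def bloch_mat_def bloch_mat_adj_def)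
  then have "det (?U' * (?M * ?U)) = of_nat Q ^ Q * det (fourier_mat V c ?z)"
    by (simp add: fourier_mat_def)
  moreover have "det (?U' * (?M * ?U)) = det ?U' * det ?U * det ?M"
    using det_mult[OF car(3) mult_carrier_mat[OF car(1,2)]] det_mult[OF car(1,2)] by (simp only: mult_ac)
  moreover have "det ?U' * det ?U = of_nat Q ^ Q"
    using arg_cong[OF bloch_mat_orthogonal[of k], of det] det_mult[OF car(3,2)] by simp
  ultimately have "complex_of_nat Q ^ Q * det ?M = complex_of_nat Q ^ Q * det (fourier_mat V c ?z)"
    by (simp only:)
  moreover have "complex_of_nat Q ^ Q \<noteq> 0" using of_nat_Q_nonzero by (rule power_not_zero)
  ultimately show ?thesis unfolding char_det_def by (simp only: mult_cancel_left) blast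
qed

text \<open>
  The dual orthogonality relation, summing over modes instead of sites, follows from
  \<open>bloch_mat_orthogonal\<close> because a left inverse of a square matrix is a right inverse.
\<close>

lemma coef_inversion:
  assumes V: "periodic d q V" and x: "x \<in> carrier_vec d"
  shows "V x = (\<Sum>l<Q. coef V (int l) * chi (int l) x)"
proof -
  have U: "bloch_mat k \<in> carrier_mat Q Q" "bloch_mat_adj k \<in> carrier_mat Q Q" for k
    by (auto simp: bloch_mat_def bloch_mat_adj_def)
  let ?k = "\<lambda>_. 0 :: real"
  have "(1 / of_nat Q) \<cdot>\<^sub>m (bloch_mat_adj ?k * bloch_mat ?k) = 1\<^sub>m Q"
    unfolding bloch_mat_orthogonal using Q_pos by (intro eq_matI) (auto simp del: of_nat_prod)
  then have "((1 / of_nat Q) \<cdot>\<^sub>m bloch_mat_adj ?k) * bloch_mat ?k = 1\<^sub>m Q"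
    by (subst mult_smult_assoc_mat[of _ Q Q _ Q]) (use U in auto)
  then have inv: "bloch_mat ?k * ((1 / of_nat Q) \<cdot>\<^sub>m bloch_mat_adj ?k) = 1\<^sub>m Q"
    by (rule mat_mult_left_right_inverse[rotated 2]) (use U in simp_all)
  have dual: "(\<Sum>l<Q. chi (int l) (site d q a) * chi (- int l) (site d q b)) = (if a = b then of_nat Q else 0)"
    if "a < Q" "b < Q" for a b
  proof -
    have "(\<Sum>l<Q. chi (int l) (site d q a) * (1 / of_nat Q * cnj (chi (int l) (site d q b)))) =
        (1\<^sub>m Q :: complex mat) $$ (a, b)"
      unfolding inv[symmetric] using that
      by (simp add: bloch_mat_def bloch_mat_adj_def scalar_prod_def chi_def atLeast0LessThan)
    then have "(\<Sum>l<Q. chi (int l) (site d q a) * chi (- int l) (site d q b)) / of_nat Q = (if a = b then 1 else 0)"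
      using that by (simp add: chi_minus sum_divide_distrib del: of_nat_prod)
    then show ?thesis using Q_pos by (auto simp: divide_simps simp del: of_nat_prod split: if_splits)
  qed
  have "cell_reduce x \<in> site d q ` {..<Q}"
    using cell_reduce_in_cell site_bij_betw[of d q] q_pos by (simp add: bij_betw_def)
  then obtain a where a: "a < Q" "cell_reduce x = site d q a" by auto
  have red: "f x = f (site d q a)" if "periodic d q f" for f
    using periodic_cell_reduce[OF that x] a by simp
  have "(\<Sum>l<Q. coef V (int l) * chi (int l) x) =
      (\<Sum>l<Q. \<Sum>b<Q. V (site d q b) / of_nat Q * (chi (int l) (site d q a) * chi (- int l) (site d q b)))"
    unfolding coef_def sum_site[symmetric] red[OF periodic_chi] sum_divide_distrib sum_distrib_right
    by (simp add: algebra_simps)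
  also have "\<dots> = (\<Sum>b<Q. V (site d q b) / of_nat Q * (if a = b then of_nat Q else 0))"
    by (subst sum.swap, unfold sum_distrib_left[symmetric], intro sum.cong refl)
      (use a(1) in \<open>simp add: dual del: of_nat_prod\<close>)
  also have "\<dots> = (\<Sum>b<Q. if a = b then V (site d q b) else 0)"
    using Q_pos by (intro sum.cong) (auto simp del: of_nat_prod)
  also have "\<dots> = V x" using a(1) red[OF V] by simp
  finally show ?thesis by simp
qed

lemma coef_shift:
  assumes V: "periodic d q V" and y: "y \<in> carrier_vec d"
  shows "coef (\<lambda>x. V (x + y)) m = chi m y * coef V m"
proof -
  have one: "chi m y * chi (- m) y = 1"
    by (simp add: chi_def bloch_def cis_mult sum_negf)
  have per: "periodic d q (\<lambda>x. V x * chi (- m) x)"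
    using V periodic_chi[of "- m"] by (simp add: periodic_def)
  have "(\<Sum>x\<in>fund_cell d q. V (x + y) * chi (- m) x) =
      (\<Sum>x\<in>fund_cell d q. chi m y * (V (x + y) * chi (- m) (x + y)))"
    using one y by (intro sum.cong) (auto simp: chi_add fund_cell_carrier mult.left_commute)
  also have "\<dots> = chi m y * (\<Sum>x\<in>fund_cell d q. V x * chi (- m) x)"
    unfolding sum_distrib_left[symmetric] using sum_fund_cell_shift[OF per y] by simp
  finally show ?thesis by (simp add: coef_def)
qed

lemma coef_real:
  assumes "\<And>x. x \<in> carrier_vec d \<Longrightarrow> V x \<in> \<real>"
  shows "coef V (- m) = cnj (coef V m)"
  unfolding coef_def using assms
  by (auto simp: chi_minus Reals_cnj_iff fund_cell_carrier intro!: sum.cong)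

end

section \<open>Separability in terms of Fourier coefficients\<close>

lemma sum_blocks_mono:
  fixes ds :: "nat \<Rightarrow> nat"
  assumes "a \<le> b"
  shows "(\<Sum>j<a. ds j) \<le> (\<Sum>j<b. ds j)"
  using assms by (intro sum_mono2) auto

lemma block_indices_cover:
  "j < (\<Sum>m<r. ds m) \<Longrightarrow> \<exists>m<r. j \<in> block_indices ds m"
proof (induction r)
  case (Suc r)
  show ?case
  proof (cases "j < (\<Sum>m<r. ds m)")
    case True
    then show ?thesis using Suc.IH less_Suc_eq by blast
  next
    case False
    then have "j \<in> block_indices ds r" using Suc.prems by (simp add: block_indices_def)
    then show ?thesis by blast
  qed
qed simp

lemma block_indices_disjoint:
  assumes "j \<in> block_indices ds a" "j \<in> block_indices ds b"
  shows "a = b"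
proof (rule ccontr)
  assume "a \<noteq> b"
  then consider "Suc a \<le> b" | "Suc b \<le> a" by linarith
  then show False
    using sum_blocks_mono[of "Suc a" b ds] sum_blocks_mono[of "Suc b" a ds] assms
    by cases (auto simp: block_indices_def)
qed

lemma block_indices_less:
  assumes "m < r" "j \<in> block_indices ds m"
  shows "j < (\<Sum>m<r. ds m)"
proof -
  have "(\<Sum>j<Suc m. ds j) \<le> (\<Sum>j<r. ds j)" using assms by (intro sum_blocks_mono) auto
  then show ?thesis using assms by (auto simp: block_indices_def)
qed

lemma block_add_unit_vec:
  assumes d: "d = (\<Sum>m<r. ds m)" and x: "x \<in> carrier_vec d"
    and k: "k < r" and s: "s < d" "s \<notin> block_indices ds k"
  shows "block ds k (x + unit_vec d s) = block ds k x"
proof (rule eq_vecI)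
  fix i assume "i < dim_vec (block ds k x)"
  then have i: "i < ds k" by (simp add: block_def)
  let ?j = "(\<Sum>j<k. ds j) + i"
  have j: "?j \<in> block_indices ds k" using i by (simp add: block_indices_def)
  then have "?j < d" "?j \<noteq> s" using block_indices_less[OF k j] d s by auto
  then show "block ds k (x + unit_vec d s) $ i = block ds k x $ i"
    using i x s by (simp add: block_def)
qed (simp add: block_def)

text \<open>
  Each summand depends on one block only, hence is unchanged by the shift along \<open>s\<close> or by the shift
  along \<open>t\<close>.
\<close>

lemma separable_mixed_difference:
  assumes d: "d = (\<Sum>m<r. ds m)" and V: "separable r ds V" and im: "i < r" "m < r" "i \<noteq> m"
    and s: "s \<in> block_indices ds i" and t: "t \<in> block_indices ds m" and x: "x \<in> carrier_vec d"
  shows "V (x + (unit_vec d s + unit_vec d t)) + V x = V (x + unit_vec d s) + V (x + unit_vec d t)"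
proof -
  obtain F where F: "\<And>n. n \<in> carrier_vec d \<Longrightarrow> V n = (\<Sum>k<r. F k (block ds k n))"
    using V unfolding separable_def d by blast
  have st: "s < d" "t < d" using block_indices_less s t im d by auto
  have e: "x + (unit_vec d s + unit_vec d t) = x + unit_vec d s + unit_vec d t"
    "x + unit_vec d s + unit_vec d t = x + unit_vec d t + unit_vec d s"
    using x by (auto intro!: eq_vecI)
  have "F k (block ds k (x + unit_vec d s + unit_vec d t)) + F k (block ds k x) =
      F k (block ds k (x + unit_vec d s)) + F k (block ds k (x + unit_vec d t))" if k: "k < r" for k
  proof (cases "s \<in> block_indices ds k")
    case True
    then have "t \<notin> block_indices ds k" using block_indices_disjoint s t im by blast
    note shift = block_add_unit_vec[OF d _ k st(2) this]
    have "x + unit_vec d s \<in> carrier_vec d" using x by simp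
    then show ?thesis by (simp only: shift x add.commute)
  next
    case False
    note shift = block_add_unit_vec[OF d _ k st(1) this]
    have "x + unit_vec d t \<in> carrier_vec d" using x by simp
    then show ?thesis unfolding e(2) by (simp only: shift x) (rule add.commute)
  qed
  moreover have "x + unit_vec d s + unit_vec d t \<in> carrier_vec d" "x + unit_vec d s \<in> carrier_vec d"
    "x + unit_vec d t \<in> carrier_vec d" using x by simp_all
  ultimately show ?thesis
    unfolding e(1) by (simp only: F x sum.distrib[symmetric]) (intro sum.cong refl, simp)
qed

context coprime_periods
begin

text \<open>
  On the \<open>l\<close>-th coefficient the mixed difference acts as multiplication by
  \<open>(omega s l - 1) * (omega t l - 1)\<close>, which is not zero.
\<close>

lemma coef_eq_0_of_mixed_difference:
  assumes V: "periodic d q V" and st: "s < d" "t < d"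
    and diff: "\<And>x. x \<in> carrier_vec d \<Longrightarrow>
      V (x + (unit_vec d s + unit_vec d t)) + V x = V (x + unit_vec d s) + V (x + unit_vec d t)"
    and l: "\<not> int (q s) dvd l" "\<not> int (q t) dvd l"
  shows "coef V l = 0"
proof -
  have add: "coef (\<lambda>x. f x + g x) l = coef f l + coef g l" for f g
    by (simp add: coef_def distrib_right sum.distrib add_divide_distrib)
  let ?e = "unit_vec d :: nat \<Rightarrow> int vec"
  have "coef (\<lambda>x. V (x + (?e s + ?e t)) + V x) l = coef (\<lambda>x. V (x + ?e s) + V (x + ?e t)) l"
    unfolding coef_def using diff by (simp add: fund_cell_carrier cong: sum.cong)
  then have "chi l (?e s + ?e t) * coef V l + coef V l = chi l (?e s) * coef V l + chi l (?e t) * coef V l"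
    unfolding add by (simp add: coef_shift[OF V])
  then have "(omega s l - 1) * (omega t l - 1) * coef V l = 0"
    using st by (simp add: chi_add chi_unit_vec algebra_simps)
  then show ?thesis using l st by (simp add: omega_eq_1_iff)
qed

text \<open>
  Every character in the Fourier expansion of \<open>Y\<close> then depends on the coordinates of one block only,
  and grouping the expansion by these blocks gives the separation.
\<close>

lemma separable_if_coef_eq_0:
  assumes d: "d = (\<Sum>m<r. ds m)" and r: "r > 0" and Y: "periodic d q Y"
    and zero: "\<And>i m s t l. i < m \<Longrightarrow> m < r \<Longrightarrow> s \<in> block_indices ds i \<Longrightarrow> t \<in> block_indices ds m \<Longrightarrow>
      \<not> int (q s) dvd int l \<Longrightarrow> \<not> int (q t) dvd int l \<Longrightarrow> l < Q \<Longrightarrow> coef Y (int l) = 0"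
  shows "separable r ds Y"
proof -
  \<comment> \<open>The block on which \<open>chi l\<close> lives; the constant character goes to block \<open>0\<close>.\<close>
  define b where "b l = (if \<exists>m<r. \<exists>j\<in>block_indices ds m. \<not> int (q j) dvd int l
    then SOME m. m < r \<and> (\<exists>j\<in>block_indices ds m. \<not> int (q j) dvd int l) else 0)" for l :: nat
  have b_less: "b l < r" for l
  proof (cases "\<exists>m<r. \<exists>j\<in>block_indices ds m. \<not> int (q j) dvd int l")
    case True
    from someI_ex[OF this] True show ?thesis by (simp add: b_def)
  next
    case False
    then show ?thesis unfolding b_def using r by (simp only: if_False)
  qed
  have b_support: "int (q j) dvd int l"
    if nz: "coef Y (int l) \<noteq> 0" and l: "l < Q" and j: "j < d" "j \<notin> block_indices ds (b l)" for l j
  proof (rule ccontr)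
    assume nd: "\<not> int (q j) dvd int l"
    obtain m where m: "m < r" "j \<in> block_indices ds m" using block_indices_cover j d by blast
    then have ex: "\<exists>m<r. \<exists>j\<in>block_indices ds m. \<not> int (q j) dvd int l" using nd by blast
    from someI_ex[OF this] obtain j' where j': "j' \<in> block_indices ds (b l)" "\<not> int (q j') dvd int l"
      using ex unfolding b_def by auto
    have "m \<noteq> b l" using m j by auto
    then consider "m < b l" | "b l < m" by linarith
    then show False using zero[of m "b l" j j' l] zero[of "b l" m j' j l] m j' nd nz l b_less by cases auto
  qed
  define F where "F m y = (\<Sum>l | l < Q \<and> b l = m. coef Y (int l) *
    (\<Prod>i<ds m. omega ((\<Sum>j<m. ds j) + i) (int l * y $ i)))" for m and y :: "int vec"
  have "Y x = (\<Sum>m<r. F m (block ds m x))" if x: "x \<in> carrier_vec d" for x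
  proof -
    have summand: "coef Y (int l) * chi (int l) x = coef Y (int l) *
        (\<Prod>i<ds m. omega ((\<Sum>j<m. ds j) + i) (int l * block ds m x $ i))"
      if l: "l < Q" "b l = m" for l m
    proof (cases "coef Y (int l) = 0")
      case False
      have sub: "block_indices ds m \<subseteq> {..<d}" using block_indices_less[of m r] b_less l d by auto
      have "chi (int l) x = (\<Prod>j<d. omega j (int l * x $ j))" by (rule chi_prod[OF x])
      also have "\<dots> = (\<Prod>j\<in>block_indices ds m. omega j (int l * x $ j))"
      proof (rule prod.mono_neutral_right[OF _ sub])
        show "\<forall>j\<in>{..<d} - block_indices ds m. omega j (int l * x $ j) = 1"
          using b_support[OF False l(1)] l(2) by (auto simp: omega_eq_1_iff)
      qed simp
      also have "\<dots> = (\<Prod>i<ds m. omega ((\<Sum>j<m. ds j) + i) (int l * x $ ((\<Sum>j<m. ds j) + i)))"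
        by (rule prod.reindex_bij_witness[of _ "\<lambda>i. (\<Sum>j<m. ds j) + i" "\<lambda>j. j - (\<Sum>j<m. ds j)"])
          (auto simp: block_indices_def)
      finally show ?thesis by (simp add: block_def)
    qed simp
    have "Y x = (\<Sum>l<Q. coef Y (int l) * chi (int l) x)" by (rule coef_inversion[OF Y x])
    also have "\<dots> = (\<Sum>m<r. \<Sum>l | l \<in> {..<Q} \<and> b l = m. coef Y (int l) * chi (int l) x)"
      using b_less by (intro sum.group[symmetric]) auto
    also have "\<dots> = (\<Sum>m<r. F m (block ds m x))"
      unfolding F_def by (intro sum.cong refl) (auto intro!: sum.cong simp: summand)
    finally show ?thesis .
  qed
  then show ?thesis unfolding separable_def d by blast
qed

end

section \<open>Isospectrality off the unit torus\<close>

context coprime_periods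
begin

lemma fourier_mat_carrier [simp]: "fourier_mat V c z \<in> carrier_mat Q Q"
  by (simp add: fourier_mat_def)

lemma laurent_entries_fourier_mat:
  assumes j: "j < d"
  shows "laurent_entries Q (\<lambda>x. fourier_mat V c (z(j := x)))"
proof -
  define rest where "rest m = (\<Sum>l\<in>{..<d} - {j}. omega l m * z l + 1 / (omega l m * z l))" for m
  have "dispersion (z(j := x)) m = omega j m * x + 1 / (omega j m * x) + rest m" for x m
    unfolding dispersion_def rest_def using j by (simp add: sum.remove[of "{..<d}" j])
  then have "fourier_mat V c (z(j := x)) = mat Q Q (\<lambda>(i, i').
      ((if i = i' then rest (int i) - c else 0) + coef V (int i - int i')) +
      (if i = i' then omega j (int i) else 0) * x + (if i = i' then 1 / omega j (int i) else 0) / x)" for x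
    unfolding fourier_mat_def by (intro eq_matI) (auto simp: algebra_simps)
  then show ?thesis unfolding laurent_entries_def by (intro exI allI) assumption
qed

text \<open>
  The variables in \<open>S\<close> leave the unit circle one at a time: in each of them the determinant is a
  Laurent polynomial, so it is determined by its values on the circle.
\<close>

lemma det_fourier_mat_eq_off_torus:
  assumes S: "finite S" "S \<subseteq> {..<d}"
    and eq: "\<And>z. (\<And>j. j \<in> S \<Longrightarrow> cmod (z j) = 1) \<Longrightarrow> (\<And>j. j \<notin> S \<Longrightarrow> z j = z0 j) \<Longrightarrow>
      det (fourier_mat V c z) = det (fourier_mat Y e z)"
    and z: "\<And>j. j \<in> S \<Longrightarrow> z j \<noteq> 0" "\<And>j. j \<notin> S \<Longrightarrow> z j = z0 j"
  shows "det (fourier_mat V c z) = det (fourier_mat Y e z)"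
proof -
  have "\<forall>z. (\<forall>j\<in>T. z j \<noteq> 0) \<longrightarrow> (\<forall>j\<in>S - T. cmod (z j) = 1) \<longrightarrow> (\<forall>j. j \<notin> S \<longrightarrow> z j = z0 j) \<longrightarrow>
      det (fourier_mat V c z) = det (fourier_mat Y e z)" if "finite T" "T \<subseteq> S" for T
    using that
  proof (induction T)
    case empty
    then show ?case using eq by auto
  next
    case (insert j T)
    show ?case
    proof (intro allI impI)
      fix z assume z: "\<forall>l\<in>insert j T. z l \<noteq> 0" "\<forall>l\<in>S - insert j T. cmod (z l) = 1"
        "\<forall>l. l \<notin> S \<longrightarrow> z l = z0 l"
      have j: "j < d" "j \<in> S" using insert.prems S by auto
      have "det (fourier_mat V c (z(j := z j))) = det (fourier_mat Y e (z(j := z j)))"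
      proof (rule laurent_det_unit_circle[OF laurent_entries_fourier_mat[OF j(1)] laurent_entries_fourier_mat[OF j(1)]])
        fix x :: complex assume x: "cmod x = 1"
        have "\<forall>l\<in>T. (z(j := x)) l \<noteq> 0" "\<forall>l\<in>S - T. cmod ((z(j := x)) l) = 1"
          "\<forall>l. l \<notin> S \<longrightarrow> (z(j := x)) l = z0 l"
          using z x j insert.hyps by auto
        then show "det (fourier_mat V c (z(j := x))) = det (fourier_mat Y e (z(j := x)))"
          using insert by blast
      qed (use z in simp)
      then show "det (fourier_mat V c z) = det (fourier_mat Y e z)" by simp
    qed
  qed
  from this[OF S(1) order_refl] z show ?thesis by blast
qed

text \<open>
  Passing to a smaller set \<open>S\<close> only freezes further quasimomenta, here at the values \<open>k0 j\<close>.
\<close>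

lemma fermi_isospectral_fourier_mat:
  assumes iso: "partially_fermi_isospectral d q S' c e V Y" and S: "S \<subseteq> S'"
  obtains z0 where "\<And>z. (\<And>j. j \<in> S \<Longrightarrow> z j \<noteq> 0) \<Longrightarrow> (\<And>j. j \<notin> S \<Longrightarrow> z j = z0 j) \<Longrightarrow>
      det (fourier_mat V c z) = det (fourier_mat Y e z)"
proof -
  from iso obtain k0 where k0: "\<And>k. (\<forall>j\<in>{..<d} - S'. k j = k0 j) \<Longrightarrow> char_det d q V k c = char_det d q Y k e"
    and S': "S' \<subseteq> {..<d}"
    unfolding partially_fermi_isospectral_def by blast
  define z0 where "z0 j = cis (2 * pi * k0 j / real (q j))" for j
  have Sd: "S \<subseteq> {..<d}" using S S' by blast
  have "det (fourier_mat V c z) = det (fourier_mat Y e z)"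
    if z: "\<And>j. j \<in> S \<Longrightarrow> cmod (z j) = 1" "\<And>j. j \<notin> S \<Longrightarrow> z j = z0 j" for z
  proof -
    define k where "k j = (if j \<in> S then real (q j) * Arg (z j) / (2 * pi) else k0 j)" for j
    have "z = (\<lambda>j. cis (2 * pi * k j / real (q j)))"
    proof
      fix j show "z j = cis (2 * pi * k j / real (q j))"
      proof (cases "j \<in> S")
        case True
        then have "q j > 0" using Sd q_pos by auto
        then have "2 * pi * k j / real (q j) = Arg (z j)" using True by (simp add: k_def)
        moreover have "cis (Arg (z j)) = z j" using rcis_cmod_Arg[of "z j"] z(1)[OF True] by (simp add: rcis_def)
        ultimately show ?thesis by simp
      qed (simp add: z(2) z0_def k_def)
    qed
    moreover have "char_det d q V k c = char_det d q Y k e"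
      using S by (intro k0) (auto simp: k_def)
    ultimately show ?thesis by (simp only: char_det_eq_det_fourier_mat)
  qed
  then have "det (fourier_mat V c z) = det (fourier_mat Y e z)"
    if "\<And>j. j \<in> S \<Longrightarrow> z j \<noteq> 0" "\<And>j. j \<notin> S \<Longrightarrow> z j = z0 j" for z
    using det_fourier_mat_eq_off_torus[of S z0 V c Y e z] that Sd finite_subset by blast
  then show ?thesis using that by blast
qed

end

text \<open>
  The mode \<open>l\<close> is non-trivial in the directions \<open>s\<close> and \<open>t\<close>. A third direction \<open>w\<close> is there to leave a
  line in the space of the variables \<open>z s\<close>, \<open>z t\<close>, \<open>z w\<close> on which the linear parts at the modes \<open>0\<close>
  and \<open>l\<close> both vanish.
\<close>

locale mode_triple = coprime_periods +
  fixes s t w :: nat and l :: int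
  assumes stw: "s < d" "t < d" "w < d" "s \<noteq> t" "s \<noteq> w" "t \<noteq> w"
    and l: "\<not> int (q s) dvd l" "\<not> int (q t) dvd l"
begin

definition linear_part :: "int \<Rightarrow> complex \<Rightarrow> complex \<Rightarrow> complex \<Rightarrow> complex" where
  "linear_part m x y z = omega s m * x + omega t m * y + omega w m * z"

text \<open>
  For a mode \<open>m\<close> this says that \<open>omega s m\<close>, \<open>omega t m\<close> and \<open>omega w m\<close> are all \<open>1\<close>; for \<open>m - l\<close> it
  says that they are \<open>a\<close>, \<open>b\<close>, \<open>c\<close>, the values at the mode \<open>l\<close>.
\<close>

definition resonant :: "int \<Rightarrow> bool" where
  "resonant m \<longleftrightarrow> int (q s) dvd m \<and> int (q t) dvd m \<and> int (q w) dvd m"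

abbreviation "a \<equiv> omega s l"
abbreviation "b \<equiv> omega t l"
abbreviation "c \<equiv> omega w l"

lemma abc_distinct: "a \<noteq> b" "a \<noteq> c" "b \<noteq> c"
  using omega_coprime(1)[of s t l l] omega_coprime(1)[of s w l l] omega_coprime(1)[of t w l l] stw l by auto

text \<open>
  The condition says that \<open>(omega s m, omega t m, omega w m)\<close> is a linear combination
  \<open>\<alpha> (a, b, c) + \<beta> (1, 1, 1)\<close>. Since \<open>a\<close>, \<open>b\<close>, \<open>c\<close> are distinct,
  \<open>unit_circle_affine_three_points\<close> gives \<open>\<alpha> = 0\<close> or \<open>\<beta> = 0\<close>. Then the three values, or their
  quotients by \<open>a\<close>, \<open>b\<close>, \<open>c\<close>, coincide, and being roots of unity of coprime orders they are \<open>1\<close>.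
\<close>

lemma linear_part_eq_0_iff: "linear_part m (b - c) (c - a) (a - b) = 0 \<longleftrightarrow> resonant m \<or> resonant (m - l)"
proof
  assume "resonant m \<or> resonant (m - l)"
  then show "linear_part m (b - c) (c - a) (a - b) = 0"
  proof
    assume "resonant m"
    then show ?thesis using stw by (simp add: resonant_def linear_part_def omega_eq_1_iff[THEN iffD2])
  next
    assume "resonant (m - l)"
    then have "omega s m = a" "omega t m = b" "omega w m = c"
      using stw by (simp_all add: resonant_def omega_eq_iff)
    then show ?thesis by (simp add: linear_part_def algebra_simps)
  qed
next
  assume zero: "linear_part m (b - c) (c - a) (a - b) = 0"
  define \<alpha> where "\<alpha> = (omega s m - omega t m) / (a - b)"
  define \<beta> where "\<beta> = omega s m - \<alpha> * a"
  have \<alpha>: "\<alpha> * (a - b) = omega s m - omega t m" using abc_distinct by (simp add: \<alpha>_def)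
  have s: "omega s m = \<alpha> * a + \<beta>" by (simp add: \<beta>_def)
  have t: "omega t m = \<alpha> * b + \<beta>" using \<alpha> by (simp add: \<beta>_def algebra_simps)
  have "(a - b) * (omega w m - (\<alpha> * c + \<beta>)) = 0"
    using zero unfolding linear_part_def s t by (simp add: algebra_simps)
  then have w: "omega w m = \<alpha> * c + \<beta>" using abc_distinct by simp
  have "\<alpha> = 0 \<or> \<beta> = 0"
    by (rule unit_circle_affine_three_points[of a b c]) (use abc_distinct s t w in \<open>simp_all flip: s t w\<close>)
  then show "resonant m \<or> resonant (m - l)"
  proof
    assume "\<alpha> = 0"
    then have "omega s m = omega t m" "omega s m = omega w m" using s t w by simp_all
    then show ?thesis
      using omega_coprime[of s t m m] omega_coprime[of s w m m] stw by (auto simp: resonant_def)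
  next
    assume "\<beta> = 0"
    then have "omega s (m - l) = omega t (m - l)" "omega s (m - l) = omega w (m - l)"
      using s t w by (simp_all add: omega_diff)
    then show ?thesis
      using omega_coprime[of s t "m - l" "m - l"] omega_coprime[of s w "m - l" "m - l"] stw
      by (auto simp: resonant_def)
  qed
qed

end

section \<open>Degeneration along a resonant ray\<close>

context mode_triple
begin

definition rest_dispersion :: "(nat \<Rightarrow> complex) \<Rightarrow> int \<Rightarrow> complex" where
  "rest_dispersion z0 m = (\<Sum>j\<in>{..<d} - {s, t, w}. omega j m * z0 j + 1 / (omega j m * z0 j))"

definition weight :: "complex \<Rightarrow> int \<Rightarrow> complex" where
  "weight \<theta> m = (if resonant m then 1 else if resonant (m - l) then \<theta> else 0)"

text \<open>
  The part of the Fourier matrix that survives the limit along the ray below: rows outside the two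
  resonant families are zero, and the rows of the second family are multiplied by \<open>\<theta>\<close>. The
  contribution of \<open>z s\<close>, \<open>z t\<close>, \<open>z w\<close> to the diagonal is left out.
\<close>

definition resonant_mat :: "(int vec \<Rightarrow> complex) \<Rightarrow> complex \<Rightarrow> (nat \<Rightarrow> complex) \<Rightarrow> complex \<Rightarrow> complex mat" where
  "resonant_mat V e z0 \<theta> = mat Q Q (\<lambda>(i, j). weight \<theta> (int i) *
     ((if i = j then rest_dispersion z0 (int i) - e else 0) + coef V (int i - int j)))"

lemma resonant_mat_carrier [simp]: "resonant_mat V e z0 \<theta> \<in> carrier_mat Q Q"
  by (simp add: resonant_mat_def)

lemma not_both_resonant: "\<not> (resonant m \<and> resonant (m - l))"
  using l dvd_diff_right_iff[of "int (q s)" m l] by (auto simp: resonant_def)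

lemma dispersion_triple:
  "dispersion (z0(s := x, t := y, w := v)) m =
     linear_part m x y v + (1 / (omega s m * x) + 1 / (omega t m * y) + 1 / (omega w m * v)) + rest_dispersion z0 m"
proof -
  let ?z = "z0(s := x, t := y, w := v)"
  let ?f = "\<lambda>j. omega j m * ?z j + 1 / (omega j m * ?z j)"
  have "dispersion ?z m = (\<Sum>j\<in>{..<d} - {s, t, w}. ?f j) + (\<Sum>j\<in>{s, t, w}. ?f j)"
    unfolding dispersion_def using stw by (intro sum.subset_diff) auto
  also have "(\<Sum>j\<in>{..<d} - {s, t, w}. ?f j) = rest_dispersion z0 m"
    unfolding rest_dispersion_def by (intro sum.cong) auto
  also have "(\<Sum>j\<in>{s, t, w}. ?f j) = linear_part m x y v +
      (1 / (omega s m * x) + 1 / (omega t m * y) + 1 / (omega w m * v))"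
    using stw by (simp add: linear_part_def)
  finally show ?thesis by (simp only: add.commute)
qed

text \<open>
  By Cramer's rule these solve \<open>x + y = \<mu>\<close>, \<open>a * x + b * y = \<theta> * \<mu>\<close>. The offset of the ray then
  contributes \<open>\<mu>\<close> to the diagonal in the first resonant family and \<open>\<theta> * \<mu>\<close> in the second; see
  \<open>linear_part_offset\<close>.
\<close>

definition offset_s :: "complex \<Rightarrow> complex \<Rightarrow> complex" where "offset_s \<mu> \<theta> = \<mu> * (\<theta> - b) / (a - b)"
definition offset_t :: "complex \<Rightarrow> complex \<Rightarrow> complex" where "offset_t \<mu> \<theta> = \<mu> * (a - \<theta>) / (a - b)"

definition ray :: "(nat \<Rightarrow> complex) \<Rightarrow> complex \<Rightarrow> complex \<Rightarrow> nat \<Rightarrow> nat \<Rightarrow> complex" where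
  "ray z0 \<mu> \<theta> n = z0(s := of_nat n * (b - c) + offset_s \<mu> \<theta>, t := of_nat n * (c - a) + offset_t \<mu> \<theta>,
     w := of_nat n * (a - b))"

lemma linear_part_offset:
  "resonant m \<Longrightarrow> linear_part m (offset_s \<mu> \<theta>) (offset_t \<mu> \<theta>) 0 = \<mu>"
  "resonant (m - l) \<Longrightarrow> linear_part m (offset_s \<mu> \<theta>) (offset_t \<mu> \<theta>) 0 = \<theta> * \<mu>"
proof -
  have sum: "offset_s \<mu> \<theta> + offset_t \<mu> \<theta> = \<mu>" "a * offset_s \<mu> \<theta> + b * offset_t \<mu> \<theta> = \<theta> * \<mu>"
    using abc_distinct by (simp_all add: offset_s_def offset_t_def divide_simps) (simp_all add: algebra_simps)
  show "linear_part m (offset_s \<mu> \<theta>) (offset_t \<mu> \<theta>) 0 = \<mu>" if "resonant m"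
    using that sum(1) stw by (simp add: resonant_def linear_part_def omega_eq_1_iff[THEN iffD2])
  show "linear_part m (offset_s \<mu> \<theta>) (offset_t \<mu> \<theta>) 0 = \<theta> * \<mu>" if "resonant (m - l)"
  proof -
    have "omega s m = a" "omega t m = b" using that stw by (simp_all add: resonant_def omega_eq_iff)
    then show ?thesis using sum(2) by (simp add: linear_part_def)
  qed
qed

lemma dispersion_ray:
  obtains err where "err \<longlonglongrightarrow> 0"
    "\<And>n. dispersion (ray z0 \<mu> \<theta> n) m = of_nat n * linear_part m (b - c) (c - a) (a - b) +
       linear_part m (offset_s \<mu> \<theta>) (offset_t \<mu> \<theta>) 0 + rest_dispersion z0 m + err n"
proof -
  \<comment> \<open>The last summand \<open>+ 0\<close> gives all three terms the shape of \<open>tendsto_inverse_linear\<close>.\<close>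
  define err where "err n = 1 / (omega s m * (of_nat n * (b - c) + offset_s \<mu> \<theta>)) +
    1 / (omega t m * (of_nat n * (c - a) + offset_t \<mu> \<theta>)) + 1 / (omega w m * (of_nat n * (a - b) + 0))" for n
  have "err \<longlonglongrightarrow> 0 + 0 + 0"
    unfolding err_def using abc_distinct by (intro tendsto_add tendsto_inverse_linear) auto
  moreover have "dispersion (ray z0 \<mu> \<theta> n) m = of_nat n * linear_part m (b - c) (c - a) (a - b) +
       linear_part m (offset_s \<mu> \<theta>) (offset_t \<mu> \<theta>) 0 + rest_dispersion z0 m + err n" for n
    unfolding ray_def dispersion_triple err_def by (simp add: linear_part_def algebra_simps)
  ultimately show ?thesis using that by simp
qed

definition row_scale :: "complex \<Rightarrow> complex \<Rightarrow> nat \<Rightarrow> int \<Rightarrow> complex" where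
  "row_scale \<mu> \<theta> n m = (if resonant m \<or> resonant (m - l) then weight \<theta> m
     else \<mu> / (of_nat n * linear_part m (b - c) (c - a) (a - b)))"

text \<open>
  Rows outside the resonant families have a diagonal entry asymptotic to \<open>n\<close> times their linear part
  and bounded other entries, so after scaling they converge to \<open>\<mu>\<close> times a unit vector. Rows of the
  second family have the diagonal shifted by \<open>\<theta> * \<mu>\<close>; as \<open>\<theta> * \<theta> = 1\<close>, multiplying them by \<open>\<theta>\<close> turns the
  shift into \<open>\<mu>\<close>, as in the first family.
\<close>

lemma scaled_fourier_mat_tendsto:
  assumes \<theta>: "\<theta> * \<theta> = 1"
  shows "(\<lambda>n. det (mat Q Q (\<lambda>(i, j). row_scale \<mu> \<theta> n (int i) * fourier_mat V e (ray z0 \<mu> \<theta> n) $$ (i, j))))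
    \<longlonglongrightarrow> det (\<mu> \<cdot>\<^sub>m 1\<^sub>m Q + resonant_mat V e z0 \<theta>)"
proof (rule tendsto_det)
  fix i j assume ij: "i < Q" "j < Q"
  define h where "h = linear_part (int i) (b - c) (c - a) (a - b)"
  define u where "u = linear_part (int i) (offset_s \<mu> \<theta>) (offset_t \<mu> \<theta>) 0"
  define v where "v = (if i = j then rest_dispersion z0 (int i) - e else 0) + coef V (int i - int j)"
  obtain err where err: "err \<longlonglongrightarrow> 0"
    and disp: "\<And>n. dispersion (ray z0 \<mu> \<theta> n) (int i) = of_nat n * h + u + rest_dispersion z0 (int i) + err n"
    unfolding h_def u_def using dispersion_ray[of z0 \<mu> \<theta> "int i"] by metis
  define f where "f n = row_scale \<mu> \<theta> n (int i) * ((if i = j then of_nat n * h + u + err n else 0) + v)" for n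
  have entry: "mat Q Q (\<lambda>(i, j). row_scale \<mu> \<theta> n (int i) * fourier_mat V e (ray z0 \<mu> \<theta> n) $$ (i, j)) $$ (i, j) = f n" for n
    using ij disp[of n] by (cases "i = j") (simp_all add: f_def v_def fourier_mat_def)
  have goal: "(\<mu> \<cdot>\<^sub>m 1\<^sub>m Q + resonant_mat V e z0 \<theta>) $$ (i, j) = (if i = j then \<mu> else 0) + weight \<theta> (int i) * v"
    using ij by (simp add: resonant_mat_def v_def)
  have ue: "(\<lambda>n. u + err n) \<longlonglongrightarrow> u"
    using tendsto_add[OF tendsto_const[of u] err] by simp
  have "f \<longlonglongrightarrow> (if i = j then \<mu> else 0) + weight \<theta> (int i) * v"
  proof (cases "resonant (int i) \<or> resonant (int i - l)")
    case True
    then have h0: "h = 0" unfolding h_def linear_part_eq_0_iff .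
    have wu: "weight \<theta> (int i) * u = \<mu>"
      using True not_both_resonant[of "int i"] \<theta>
      by (auto simp: weight_def u_def linear_part_offset mult.assoc[symmetric])
    have "f = (\<lambda>n. weight \<theta> (int i) * ((if i = j then u + err n else 0) + v))"
      using True by (simp add: f_def fun_eq_iff row_scale_def h0)
    moreover have "(\<lambda>n. weight \<theta> (int i) * ((if i = j then u + err n else 0) + v))
        \<longlonglongrightarrow> weight \<theta> (int i) * ((if i = j then u else 0) + v)"
      using ue by (cases "i = j") (auto intro!: tendsto_intros)
    moreover have "weight \<theta> (int i) * ((if i = j then u else 0) + v) =
        (if i = j then \<mu> else 0) + weight \<theta> (int i) * v"
      using wu by (cases "i = j") (simp_all add: distrib_left)
    ultimately show ?thesis by simp
  next
    case False
    then have h: "h \<noteq> 0" unfolding h_def linear_part_eq_0_iff .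
    have w0: "weight \<theta> (int i) = 0" using False by (simp add: weight_def)
    \<comment> \<open>The factor \<open>1\<close> and the summand \<open>0\<close> match the form of \<open>tendsto_inverse_linear\<close>.\<close>
    have inv: "(\<lambda>n. 1 / (h * (of_nat n * 1 + 0))) \<longlonglongrightarrow> (0 :: complex)"
      by (rule tendsto_inverse_linear) (use h in auto)
    have "(\<lambda>n. \<mu> * ((if i = j then 1 else 0) +
        1 / (h * (of_nat n * 1 + 0)) * ((if i = j then u + err n else 0) + v)))
        \<longlonglongrightarrow> \<mu> * ((if i = j then 1 else 0) + 0 * ((if i = j then u else 0) + v))"
      using ue by (intro tendsto_mult tendsto_add tendsto_const inv) simp_all
    moreover have "eventually (\<lambda>n. \<mu> * ((if i = j then 1 else 0) +
        1 / (h * (of_nat n * 1 + 0)) * ((if i = j then u + err n else 0) + v)) = f n) sequentially"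
      using eventually_gt_at_top[of 0]
    proof eventually_elim
      case (elim n)
      have "row_scale \<mu> \<theta> n (int i) = \<mu> / (of_nat n * h)" using False by (simp add: row_scale_def h_def)
      then have fn: "f n = \<mu> / (of_nat n * h) * ((if i = j then of_nat n * h + u + err n else 0) + v)"
        by (simp only: f_def)
      show ?case unfolding fn using h elim by (cases "i = j") (simp_all add: field_simps)
    qed
    ultimately have "f \<longlonglongrightarrow> \<mu> * ((if i = j then 1 else 0) + 0 * ((if i = j then u else 0) + v))"
      by (rule Lim_transform_eventually)
    then show ?thesis using w0 by (simp split: if_splits)
  qed
  then show "(\<lambda>n. mat Q Q (\<lambda>(i, j). row_scale \<mu> \<theta> n (int i) * fourier_mat V e (ray z0 \<mu> \<theta> n) $$ (i, j)) $$ (i, j))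
    \<longlonglongrightarrow> (\<mu> \<cdot>\<^sub>m 1\<^sub>m Q + resonant_mat V e z0 \<theta>) $$ (i, j)"
    unfolding entry goal .
qed auto

lemma eventually_ray_nonzero:
  "eventually (\<lambda>n. \<forall>j\<in>{s, t, w}. ray z0 \<mu> \<theta> n j \<noteq> 0) sequentially"
proof -
  have ev: "eventually (\<lambda>n. of_nat n * p + x \<noteq> (0 :: complex)) sequentially" if "p \<noteq> 0" for p x
  proof -
    obtain N where N: "cmod (- x / p) < real N" using reals_Archimedean2 by blast
    show ?thesis using eventually_ge_at_top[of N]
    proof eventually_elim
      case (elim n)
      show ?case
      proof
        assume "of_nat n * p + x = 0"
        then have "of_nat n = - x / p" using that by (simp add: field_simps add_eq_0_iff)
        then have "real n = cmod (- x / p)" by (metis norm_of_nat)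
        then show False using N elim by simp
      qed
    qed
  qed
  have ne: "b - c \<noteq> 0" "c - a \<noteq> 0" "a - b \<noteq> 0" using abc_distinct by auto
  show ?thesis
    using ev[OF ne(1), of "offset_s \<mu> \<theta>"] ev[OF ne(2), of "offset_t \<mu> \<theta>"] ev[OF ne(3), of 0]
    by eventually_elim (use stw in \<open>auto simp: ray_def\<close>)
qed

text \<open>
  Along the ray all three variables are eventually non-zero, so the scaled determinants for \<open>V\<close> and \<open>Y\<close>
  agree there, and the row scalings do not depend on the potential.
\<close>

lemma char_poly_resonant_mat_eq:
  assumes \<theta>: "\<theta> * \<theta> = 1"
    and eq: "\<And>z. (\<And>j. j \<in> {s, t, w} \<Longrightarrow> z j \<noteq> 0) \<Longrightarrow> (\<And>j. j \<notin> {s, t, w} \<Longrightarrow> z j = z0 j) \<Longrightarrow>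
      det (fourier_mat V e z) = det (fourier_mat Y e' z)"
  shows "char_poly (resonant_mat V e z0 \<theta>) = char_poly (resonant_mat Y e' z0 \<theta>)"
proof (rule char_poly_eqI)
  fix \<mu> :: complex assume "\<mu> \<noteq> 0"
  let ?G = "\<lambda>V e n. det (mat Q Q (\<lambda>(i, j). row_scale \<mu> \<theta> n (int i) * fourier_mat V e (ray z0 \<mu> \<theta> n) $$ (i, j)))"
  have "eventually (\<lambda>n. ?G V e n = ?G Y e' n) sequentially"
    using eventually_ray_nonzero[of z0 \<mu> \<theta>]
  proof eventually_elim
    case (elim n)
    have "det (fourier_mat V e (ray z0 \<mu> \<theta> n)) = det (fourier_mat Y e' (ray z0 \<mu> \<theta> n))"
      using elim by (intro eq) (auto simp: ray_def)
    then show ?case by (simp add: det_scale_rows)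
  qed
  then have "?G Y e' \<longlonglongrightarrow> det (\<mu> \<cdot>\<^sub>m 1\<^sub>m Q + resonant_mat V e z0 \<theta>)"
    by (rule Lim_transform_eventually[OF scaled_fourier_mat_tendsto[OF \<theta>]])
  then show "det (\<mu> \<cdot>\<^sub>m 1\<^sub>m Q + resonant_mat V e z0 \<theta>) = det (\<mu> \<cdot>\<^sub>m 1\<^sub>m Q + resonant_mat Y e' z0 \<theta>)"
    using scaled_fourier_mat_tendsto[OF \<theta>] LIMSEQ_unique by blast
qed auto

definition opposite :: "nat \<Rightarrow> nat \<Rightarrow> bool" where
  "opposite i j \<longleftrightarrow> resonant (int i) \<and> resonant (int j - l) \<or> resonant (int i - l) \<and> resonant (int j)"

text \<open>
  The product of the weights of rows \<open>i\<close> and \<open>j\<close> is odd in \<open>\<theta>\<close> exactly when the rows lie in opposite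
  families. Then \<open>i \<noteq> j\<close>, so the diagonal with its spectral parameter does not enter.
\<close>

lemma trace_sq_resonant_mat_diff:
  "trace_sq (resonant_mat V e z0 1) - trace_sq (resonant_mat V e z0 (- 1)) =
     2 * (\<Sum>i<Q. \<Sum>j<Q. if opposite i j then coef V (int i - int j) * coef V (int j - int i) else 0)"
proof -
  have "resonant_mat V e z0 1 $$ (i, j) * resonant_mat V e z0 1 $$ (j, i) -
      resonant_mat V e z0 (- 1) $$ (i, j) * resonant_mat V e z0 (- 1) $$ (j, i) =
      2 * (if opposite i j then coef V (int i - int j) * coef V (int j - int i) else 0)"
    if ij: "i < Q" "j < Q" for i j
  proof (cases "opposite i j")
    case True
    then have "i \<noteq> j" using not_both_resonant by (auto simp: opposite_def)
    then show ?thesis using True ij not_both_resonant[of "int i"] not_both_resonant[of "int j"]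
      by (auto simp: resonant_mat_def weight_def opposite_def)
  next
    case False
    then have "weight 1 (int i) * weight 1 (int j) = weight (- 1) (int i) * weight (- 1) (int j)"
      by (auto simp: weight_def opposite_def)
    then have "weight 1 (int i) * weight 1 (int j) * r = weight (- 1) (int i) * weight (- 1) (int j) * r" for r
      by simp
    then show ?thesis using False ij by (simp add: resonant_mat_def mult_ac)
  qed
  then show ?thesis
    unfolding trace_sq_def by (simp add: resonant_mat_def[THEN arg_cong[of _ _ dim_row]] sum_distrib_left flip: sum_subtractf)
qed

text \<open>
  For \<open>V\<close> the sum over opposite pairs vanishes termwise, as \<open>i - j\<close> is congruent to \<open>l\<close> or \<open>- l\<close> modulo
  \<open>q s\<close> and \<open>q t\<close>. For real \<open>Y\<close> its terms are squared absolute values, so each of them is zero, in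
  particular the one for the pair \<open>i = l\<close>, \<open>j = 0\<close>.
\<close>

lemma coef_eq_0:
  assumes V: "\<And>m. \<not> int (q s) dvd m \<Longrightarrow> \<not> int (q t) dvd m \<Longrightarrow> coef V m = 0"
    and Y: "\<And>x. x \<in> carrier_vec d \<Longrightarrow> Y x \<in> \<real>"
    and eq: "\<And>z. (\<And>j. j \<in> {s, t, w} \<Longrightarrow> z j \<noteq> 0) \<Longrightarrow> (\<And>j. j \<notin> {s, t, w} \<Longrightarrow> z j = z0 j) \<Longrightarrow>
      det (fourier_mat V e z) = det (fourier_mat Y e' z)"
    and lQ: "0 \<le> l" "l < int Q"
  shows "coef Y l = 0"
proof -
  let ?P = "\<lambda>V. \<Sum>i<Q. \<Sum>j<Q. if opposite i j then coef V (int i - int j) * coef V (int j - int i) else 0"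
  have "trace_sq (resonant_mat V e z0 \<theta>) = trace_sq (resonant_mat Y e' z0 \<theta>)" if "\<theta> * \<theta> = 1" for \<theta>
    by (rule trace_sq_char_poly_cong[OF resonant_mat_carrier resonant_mat_carrier char_poly_resonant_mat_eq[OF that eq]])
  from this[of 1] this[of "- 1"] have VY: "?P V = ?P Y"
    using trace_sq_resonant_mat_diff[of V e z0] trace_sq_resonant_mat_diff[of Y e' z0] by simp
  have V0: "?P V = 0"
  proof -
    have "coef V (int i - int j) = 0" if "opposite i j" for i j
    proof (rule V)
      have "\<not> int (q r) dvd int i - int j" if r: "r = s \<or> r = t" for r
      proof
        assume ij: "int (q r) dvd int i - int j"
        from \<open>opposite i j\<close> r consider "int (q r) dvd int i" "int (q r) dvd int j - l"
          | "int (q r) dvd int i - l" "int (q r) dvd int j"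
          unfolding opposite_def resonant_def by blast
        then have "int (q r) dvd l"
        proof cases
          case 1
          from dvd_diff[OF dvd_diff[OF this] ij] show ?thesis by simp
        next
          case 2
          from dvd_diff[OF dvd_add[OF ij 2(2)] 2(1)] show ?thesis by simp
        qed
        then show False using r l by auto
      qed
      then show "\<not> int (q s) dvd int i - int j" "\<not> int (q t) dvd int i - int j" by blast+
    qed
    then show ?thesis by (auto intro!: sum.neutral)
  qed
  have YR: "?P Y = of_real (\<Sum>i<Q. \<Sum>j<Q. if opposite i j then (cmod (coef Y (int i - int j)))\<^sup>2 else 0)"
  proof -
    have "coef Y m * coef Y (- m) = of_real ((cmod (coef Y m))\<^sup>2)" for m
      using coef_real[of Y m] Y complex_norm_square[of "coef Y m"] by simp
    from this[of "int i - int j" for i j]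
    have "coef Y (int i - int j) * coef Y (int j - int i) = of_real ((cmod (coef Y (int i - int j)))\<^sup>2)" for i j
      by simp
    then show ?thesis unfolding of_real_sum by (intro sum.cong refl) simp
  qed
  have "(\<Sum>i<Q. \<Sum>j<Q. if opposite i j then (cmod (coef Y (int i - int j)))\<^sup>2 else 0) = 0"
    using trans[OF YR[symmetric] trans[OF VY[symmetric] V0]] by (simp only: of_real_eq_0_iff)
  then have "(\<Sum>j<Q. if opposite i j then (cmod (coef Y (int i - int j)))\<^sup>2 else 0) = 0" if "i < Q" for i
    by (rule sum_nonneg_0[rotated 2]) (use that in \<open>auto intro: sum_nonneg\<close>)
  then have "(if opposite i j then (cmod (coef Y (int i - int j)))\<^sup>2 else 0) = 0" if "i < Q" "j < Q" for i j
    by (rule sum_nonneg_0[rotated 2]) (use that in auto)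
  moreover have "opposite (nat l) 0" "nat l < Q" "0 < Q"
    using lQ Q_pos by (simp_all add: opposite_def resonant_def del: of_nat_prod)
  ultimately show ?thesis using lQ(1) by fastforce
qed

end

theorem theorem3p3:
  fixes d r :: nat and ds q :: "nat \<Rightarrow> nat" and V Y :: "int vec \<Rightarrow> complex"
  assumes r: "r \<ge> 2"
    and ds: "\<forall>m<r. ds m \<ge> 1"
    and d: "d = (\<Sum>m<r. ds m)" "d \<ge> 3"
    and q_pos: "\<forall>j<d. q j > 0"
    and q_coprime: "\<forall>i<d. \<forall>j<d. i \<noteq> j \<longrightarrow> coprime (q i) (q j)"
    and V_per: "periodic d q V" and Y_per: "periodic d q Y"
    and V_real: "\<forall>n\<in>carrier_vec d. V n \<in> \<real>"
    and Y_real: "\<forall>n\<in>carrier_vec d. Y n \<in> \<real>"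
    and V_sep: "separable r ds V"
    and iso: "\<forall>i m. i < m \<and> m < r \<longrightarrow>
      (\<forall>s\<in>block_indices ds i. \<forall>t\<in>block_indices ds m.
        \<exists>(z1 :: complex) (z2 :: complex) S. S \<subseteq> {..<d} \<and> s \<in> S \<and> t \<in> S \<and> card S \<ge> 3 \<and>
          partially_fermi_isospectral d q S z1 z2 V Y)"
  shows "separable r ds Y"
proof -
  interpret coprime_periods d q using q_pos q_coprime by unfold_locales auto
  show ?thesis
  proof (rule separable_if_coef_eq_0[OF d(1) _ Y_per])
    fix i m s t l
    assume im: "i < m" "m < r" and s: "s \<in> block_indices ds i" and t: "t \<in> block_indices ds m"
      and nl: "\<not> int (q s) dvd int l" "\<not> int (q t) dvd int l" "l < (\<Prod>j<d. q j)"
    have st: "s < d" "t < d"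
      using block_indices_less[of i r s ds] block_indices_less[OF im(2) t] im s d(1) by simp_all
    have "s \<noteq> t" using block_indices_disjoint[of s ds i m] s t im(1) by blast
    from iso[rule_format, OF conjI[OF im] s t]
    obtain e e' S where S: "S \<subseteq> {..<d}" "s \<in> S" "t \<in> S" "card S \<ge> 3"
      and fermi: "partially_fermi_isospectral d q S e e' V Y"
      by blast
    have "\<not> S \<subseteq> {s, t}" using card_mono[of "{s, t}" S] S(4) \<open>s \<noteq> t\<close> by auto
    then obtain w where w: "w \<in> S" "w \<noteq> s" "w \<noteq> t" by auto
    interpret mode_triple d q s t w "int l"
      using st \<open>s \<noteq> t\<close> w S(1) nl by unfold_locales auto
    obtain z0 where z0: "\<And>z. (\<And>j. j \<in> {s, t, w} \<Longrightarrow> z j \<noteq> 0) \<Longrightarrow> (\<And>j. j \<notin> {s, t, w} \<Longrightarrow> z j = z0 j) \<Longrightarrow>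
        det (fourier_mat V e z) = det (fourier_mat Y e' z)"
      using fermi_isospectral_fourier_mat[OF fermi, of "{s, t, w}"] S w by blast
    show "coef Y (int l) = 0"
    proof (rule coef_eq_0[where ?z0.0 = z0 and V = V and e = e and e' = e'])
      fix k assume k: "\<not> int (q s) dvd k" "\<not> int (q t) dvd k"
      show "coef V k = 0"
        by (rule coef_eq_0_of_mixed_difference[OF V_per st(1,2) _ k])
          (rule separable_mixed_difference[OF d(1) V_sep _ im(2) _ s t], use im in auto)
    qed (use Y_real nl(3) z0 in \<open>auto simp del: of_nat_prod\<close>)
  qed (use r in simp)
qed

end
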